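(* Let $t\mapsto A(t)$ be a real analytic map from an open interval $I$ to $\mathbb{P}(2n)$, and let $[a,b]$ be any compact interval contained in $I$. Then for each $j=1,\dots,n$ the map $t\mapsto d_j(t)=d_j(A(t))$ is piecewise real analytic on $[a,b]$. Further, for each $t\in[a,b]$ one can find a symplectic eigenbasis $\{u_1(t),\dots,u_n(t),v_1(t),\dots,v_n(t)\}$ of $A(t)$ corresponding to $d_1(t),\dots,d_n(t)$ such that the maps $u_1,\dots,u_n,v_1,\dots,v_n$ are also piecewise real analytic on $[a,b]$.
   Context: Let $J=\begin{bmatrix}O & I_n\\ -I_n & O\end{bmatrix}$ ($2n\times 2n$). A real $2n\times 2n$ matrix $M$ is symplectic if $M^TJM=J$. $\mathbb{P}(2n)$ denotes the set of $2n\times 2n$ real symmetric positive definite matrices. By Williamson's theorem, for every $A\in\mathbb{P}(2n)$ there is a symplectic $M$ with $M^TAM=\begin{bmatrix}D&O\\O&D\end{bmatrix}$, $D=\mathrm{diag}(d_1(A),\dots,d_n(A))$, where $0<d_1(A)\le\dots\le d_n(A)$ are uniquely determined by $A$; they are the symplectic eigenvalues of $A$, always listed in increasing order. $\langle\cdot,\cdot\rangle$ is the Euclidean inner product. A symplectic basis of $\mathbb{R}^{2n}$ is a set $\{u_1,\dots,u_n,v_1,\dots,v_n\}$ with $\langle u_i,Jv_j\rangle=\delta_{ij}$ and $\langle u_i,Ju_j\rangle=\langle v_i,Jv_j\rangle=0$ for all $i,j$. A symplectic eigenbasis of $A$ corresponding to $d_1,\dots,d_n$ is a symplectic basis with $Au_i=d_iJv_i$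 and $Av_i=-d_iJu_i$ for each $i$. A map $f$ on $[a,b]$ is piecewise real analytic if there is a partition $a=s_0<s_1<\dots<s_r=b$ such that on each open subinterval $(s_{i-1},s_i)$ the map $f$ agrees with a map that is real analytic on a neighbourhood of $[s_{i-1},s_i]$. *)

theory Defs
  imports "HOL-Analysis.Analysis"
begin

text \<open>
  The half-dimension \<open>n\<close> is \<open>CARD('n)\<close>; the linear order on \<open>'n\<close> plays the role of the order on
  \<open>{1,\<dots>,n}\<close>.  Vectors in \<open>2n\<close>-space are indexed by \<open>'n + 'n\<close>, with \<open>Inl\<close> for the first block of
  \<open>n\<close> coordinates and \<open>Inr\<close> for the second.
\<close>

definition block_matrix ::
  "'a^'n^'n \<Rightarrow> 'a^'n^'n \<Rightarrow> 'a^'n^'n \<Rightarrow> 'a^'n^'n \<Rightarrow> 'a^('n + 'n)^('n + 'n)" where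
  "block_matrix P Q R S = (\<chi> i j.
     (case i of
        Inl k \<Rightarrow> (case j of Inl l \<Rightarrow> P $ k $ l | Inr l \<Rightarrow> Q $ k $ l)
      | Inr k \<Rightarrow> (case j of Inl l \<Rightarrow> R $ k $ l | Inr l \<Rightarrow> S $ k $ l)))"

definition diagonal :: "('n \<Rightarrow> real) \<Rightarrow> real^'n^'n" where
  "diagonal d = (\<chi> i j. if i = j then d i else 0)"

definition J :: "real^('n::finite + 'n)^('n + 'n)" where
  "J = block_matrix 0 (mat 1) (- mat 1) 0"

definition symplectic :: "real^('n::finite + 'n)^('n + 'n) \<Rightarrow> bool" where
  "symplectic M \<longleftrightarrow> transpose M ** J ** M = J"

definition positive_definite :: "real^'m^'m \<Rightarrow> bool" where
  "positive_definite A \<longleftrightarrow> transpose A = A \<and> (\<forall>x. x \<noteq> 0 \<longrightarrow> 0 < x \<bullet> (A *v x))"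

text \<open>
  By Williamson's theorem, the description below determines exactly one \<open>d\<close> whenever \<open>A\<close> is
  positive definite; for other \<open>A\<close> the value is irrelevant.
\<close>

definition symplectic_eigenvalues ::
  "real^('n::{finite,linorder} + 'n)^('n + 'n) \<Rightarrow> 'n \<Rightarrow> real" where
  "symplectic_eigenvalues A = (THE d. (\<forall>j. 0 < d j) \<and> mono d \<and>
     (\<exists>M. symplectic M \<and> transpose M ** A ** M = block_matrix (diagonal d) 0 0 (diagonal d)))"

definition symplectic_basis ::
  "('n::finite \<Rightarrow> real^('n + 'n)) \<Rightarrow> ('n \<Rightarrow> real^('n + 'n)) \<Rightarrow> bool" where
  "symplectic_basis u v \<longleftrightarrow> (\<forall>i j.
     u i \<bullet> (J *v v j) = (if i = j then 1 else 0) \<and>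
     u i \<bullet> (J *v u j) = 0 \<and> v i \<bullet> (J *v v j) = 0)"

definition symplectic_eigenbasis ::
  "real^('n::finite + 'n)^('n + 'n) \<Rightarrow> ('n \<Rightarrow> real) \<Rightarrow>
     ('n \<Rightarrow> real^('n + 'n)) \<Rightarrow> ('n \<Rightarrow> real^('n + 'n)) \<Rightarrow> bool" where
  "symplectic_eigenbasis A d u v \<longleftrightarrow> symplectic_basis u v \<and>
     (\<forall>i. A *v u i = d i *\<^sub>R (J *v v i) \<and> A *v v i = - d i *\<^sub>R (J *v u i))"

definition real_analytic_on :: "(real \<Rightarrow> 'a::real_normed_vector) \<Rightarrow> real set \<Rightarrow> bool" where
  "real_analytic_on f S \<longleftrightarrow> (\<forall>x\<in>S. \<exists>c. \<exists>r>0. \<forall>y. \<bar>y - x\<bar> < r \<longrightarrow>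
     (\<lambda>k. (y - x) ^ k *\<^sub>R c k) sums f y)"

text \<open>
  The number \<open>r\<close> of pieces may be \<open>0\<close>, which happens exactly for the degenerate interval \<open>a = b\<close>.
  As usual, nothing is required of the values of \<open>f\<close> at the partition points.
\<close>

definition piecewise_real_analytic ::
  "(real \<Rightarrow> 'a::real_normed_vector) \<Rightarrow> real \<Rightarrow> real \<Rightarrow> bool" where
  "piecewise_real_analytic f a b \<longleftrightarrow> (\<exists>(r::nat) s. s 0 = a \<and> s r = b \<and>
     (\<forall>i<r. s i < s (Suc i) \<and>
       (\<exists>g U. open U \<and> {s i..s (Suc i)} \<subseteq> U \<and> real_analytic_on g U \<and>
         (\<forall>t\<in>{s i<..<s (Suc i)}. f t = g t))))"

end

theory Submission
  imports Defs "HOL-Complex_Analysis.Complex_Analysis"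
begin

text \<open>
  The symplectic eigenvectors of \<open>A\<close> are eigenvectors of \<open>T = - (J A)\<^sup>2\<close>, which is self-adjoint
    for the
  inner product given by \<open>A\<close>: if \<open>T y = d\<^sup>2 y\<close>, then suitable multiples of \<open>y\<close> and \<open>J A y\<close> form a
  symplectic pair for \<open>d\<close>, and the \<open>A\<close>-orthogonal complement of the pair is again invariant.  So one
  analytic eigenvector near a given point suffices; the rest follows by deflation.

  An analytic eigenvector in the range of a commuting analytic projection \<open>P\<close> is found as in
    Rellich's
  theorem, by induction on the rank of \<open>P\<close>.  Take a Rayleigh quotient \<open>l\<close> along \<open>y = P e\<close>.  Either
  \<open>(T - l) P\<close> vanishes identically and \<open>y\<close> is an eigenvector, or \<open>(T - l) P = (t - x)\<^sup>k C\<close> with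
  \<open>C(x) \<noteq> 0\<close>.  In the second case \<open>C(x)\<close> is not a multiple of \<open>P(x)\<close>, because its Rayleigh
    quotient along
  \<open>y(x)\<close> is \<open>0\<close>; hence a polynomial in \<open>C\<close> is at \<open>x\<close> a proper nonzero spectral projection, and
    the iteration
  \<open>X \<mapsto> 3 X\<^sup>2 - 2 X\<^sup>3\<close> corrects it to a projection of smaller rank near \<open>x\<close>.  The iteration
    converges uniformly
  on a complex neighbourhood, so analyticity survives in the limit.

  The sign of an analytic function is constant on each side of a point, which makes the order of the
  eigenvalues constant there; compactness of \<open>[a, b]\<close> gives the partition.
\<close>

section \<open>Germs of real analytic functions\<close>

text \<open>Analyticity is encoded by a holomorphic extension \<open>F\<close> of the germ instead
  of a power series, so that square roots, orders of zeros and uniform limits can be taken from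
  complex analysis.\<close>

definition real_analytic_at :: "(real \<Rightarrow> real) \<Rightarrow> real \<Rightarrow> bool" where
  "real_analytic_at f x \<longleftrightarrow> (\<exists>F. F analytic_on {complex_of_real x} \<and>
     (\<forall>\<^sub>F t in nhds x. complex_of_real (f t) = F (of_real t)))"

lemma eventually_nhds_of_real:
  assumes "eventually P (nhds (complex_of_real x))"
  shows "\<forall>\<^sub>F t in nhds x. P (complex_of_real t)"
proof -
  have "filterlim complex_of_real (nhds (complex_of_real x)) (nhds x)"
    by (intro tendsto_of_real filterlim_ident)
  then show ?thesis using assms by (simp add: filterlim_iff)
qed

lemma eventually_nhds_imp_at: "eventually P (nhds x) \<Longrightarrow> eventually P (at x within S)"
  unfolding eventually_at_filter by (erule eventually_mono) simp

lemma real_analytic_at_const [intro!]: "real_analytic_at (\<lambda>t. c) x"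
  unfolding real_analytic_at_def by (intro exI[of _ "\<lambda>_. of_real c"]) (auto intro!: analytic_intros)

lemma real_analytic_at_ident [intro!]: "real_analytic_at (\<lambda>t. t) x"
  unfolding real_analytic_at_def by (intro exI[of _ "\<lambda>z. z"]) (auto intro!: analytic_intros)

lemma real_analytic_at_add [intro!]:
  assumes "real_analytic_at f x" "real_analytic_at g x" shows "real_analytic_at (\<lambda>t. f t + g t) x"
proof -
  obtain F G where F: "F analytic_on {complex_of_real x}" "G analytic_on {complex_of_real x}"
    and e: "\<forall>\<^sub>F t in nhds x. complex_of_real (f t) = F (of_real t)"
    "\<forall>\<^sub>F t in nhds x. complex_of_real (g t) = G (of_real t)"
    using assms unfolding real_analytic_at_def by blast
  have "\<forall>\<^sub>F t in nhds x. complex_of_real (f t + g t) = F (of_real t) + G (of_real t)"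
    using e by eventually_elim simp
  with analytic_on_add[OF F] show ?thesis unfolding real_analytic_at_def by blast
qed

lemma real_analytic_at_mult [intro!]:
  assumes "real_analytic_at f x" "real_analytic_at g x" shows "real_analytic_at (\<lambda>t. f t * g t) x"
proof -
  obtain F G where F: "F analytic_on {complex_of_real x}" "G analytic_on {complex_of_real x}"
    and e: "\<forall>\<^sub>F t in nhds x. complex_of_real (f t) = F (of_real t)"
    "\<forall>\<^sub>F t in nhds x. complex_of_real (g t) = G (of_real t)"
    using assms unfolding real_analytic_at_def by blast
  have "\<forall>\<^sub>F t in nhds x. complex_of_real (f t * g t) = F (of_real t) * G (of_real t)"
    using e by eventually_elim simp
  with analytic_on_mult[OF F] show ?thesis unfolding real_analytic_at_def by blast
qed

lemma real_analytic_at_uminus [intro!]: "real_analytic_at f x \<Longrightarrow> real_analytic_at (\<lambda>t. - f t) x"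
  using real_analytic_at_mult[of "\<lambda>_. -1" x f] by simp blast

lemma real_analytic_at_diff [intro!]:
  "real_analytic_at f x \<Longrightarrow> real_analytic_at g x \<Longrightarrow> real_analytic_at (\<lambda>t. f t - g t) x"
  using real_analytic_at_add[of f x "\<lambda>t. - g t"] by simp blast

lemma real_analytic_at_sum [intro!]:
  "(\<And>i. i \<in> S \<Longrightarrow> real_analytic_at (f i) x) \<Longrightarrow> real_analytic_at (\<lambda>t. \<Sum>i\<in>S. f i t) x"
  by (induction S rule: infinite_finite_induct) auto

lemma real_analytic_at_power [intro!]: "real_analytic_at f x \<Longrightarrow> real_analytic_at (\<lambda>t. f t ^ k) x"
  by (induction k) auto

lemma real_analytic_at_inverse:
  assumes "real_analytic_at f x" "f x \<noteq> 0" shows "real_analytic_at (\<lambda>t. inverse (f t)) x"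
proof -
  obtain F where F: "F analytic_on {complex_of_real x}"
    and e: "\<forall>\<^sub>F t in nhds x. complex_of_real (f t) = F (of_real t)"
    using assms unfolding real_analytic_at_def by blast
  have "F (of_real x) \<noteq> 0" using eventually_nhds_x_imp_x[OF e] assms(2) by auto
  then have "(\<lambda>z. inverse (F z)) analytic_on {complex_of_real x}"
    using F by (intro analytic_on_inverse) auto
  moreover have "\<forall>\<^sub>F t in nhds x. complex_of_real (inverse (f t)) = inverse (F (of_real t))"
    using e by eventually_elim (metis of_real_inverse)
  ultimately show ?thesis unfolding real_analytic_at_def by blast
qed

lemma real_analytic_at_divide:
  "real_analytic_at f x \<Longrightarrow> real_analytic_at g x \<Longrightarrow> g x \<noteq> 0 \<Longrightarrow> real_analytic_at (\<lambda>t. f t / g t) x"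
  unfolding divide_inverse by (intro real_analytic_at_mult real_analytic_at_inverse)

lemma isCont_of_real_comp:
  assumes "isCont F (complex_of_real x)" shows "isCont (\<lambda>t. F (complex_of_real t)) x"
  by (rule isCont_o2[where f = complex_of_real and g = F, OF _ assms]) (intro continuous_of_real
    continuous_ident)

lemma real_analytic_at_isCont:
  assumes "real_analytic_at f x" shows "isCont f x"
proof -
  obtain F where F: "F analytic_on {complex_of_real x}"
    and e: "\<forall>\<^sub>F t in nhds x. complex_of_real (f t) = F (of_real t)"
    using assms unfolding real_analytic_at_def by blast
  have "isCont F (complex_of_real x)"
    using F by (simp add: analytic_at_imp_isCont)
  then have "isCont (\<lambda>t. Re (F (complex_of_real t))) x"
    by (rule isCont_Re[OF isCont_of_real_comp])
  moreover have "\<forall>\<^sub>F t in nhds x. f t = Re (F (of_real t))"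
    using e by eventually_elim (metis Re_complex_of_real)
  ultimately show ?thesis by (simp add: isCont_cong)
qed

lemma isCont_eventually_pos:
  fixes f :: "real \<Rightarrow> real"
  assumes "isCont f x" "f x > 0" shows "\<forall>\<^sub>F t in nhds x. f t > 0"
proof (rule order_tendstoD(1))
  show "filterlim f (nhds (f x)) (nhds x)"
    using assms(1) unfolding isCont_def tendsto_at_iff_tendsto_nhds .
qed (rule assms(2))

text \<open>\<open>csqrt\<close> is analytic off the nonpositive axis, and near \<open>x\<close> the
  values of \<open>f\<close> stay positive, where \<open>csqrt\<close> and \<open>sqrt\<close>
  agree.\<close>

lemma real_analytic_at_sqrt:
  assumes "real_analytic_at f x" "f x > 0" shows "real_analytic_at (\<lambda>t. sqrt (f t)) x"
proof -
  obtain F where F: "F analytic_on {complex_of_real x}"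
    and e: "\<forall>\<^sub>F t in nhds x. complex_of_real (f t) = F (of_real t)"
    using assms unfolding real_analytic_at_def by blast
  have Fx: "F (of_real x) = of_real (f x)" using eventually_nhds_x_imp_x[OF e] by simp
  have "(\<lambda>z. csqrt (F z)) analytic_on {complex_of_real x}"
    using F Fx assms(2) by (intro analytic_on_csqrt') auto
  moreover have "\<forall>\<^sub>F t in nhds x. f t > 0"
    using real_analytic_at_isCont[OF assms(1)] assms(2) by (rule isCont_eventually_pos)
  with e have "\<forall>\<^sub>F t in nhds x. complex_of_real (sqrt (f t)) = csqrt (F (of_real t))"
    by eventually_elim (metis of_real_sqrt less_imp_le)
  ultimately show ?thesis unfolding real_analytic_at_def by blast
qed

text \<open>The extension \<open>F\<close> is holomorphic on a whole ball and agrees with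
  \<open>f\<close> around every nearby real point, so it serves at all of them. This leads from
  analyticity at a point to analyticity on an interval.\<close>

lemma real_analytic_at_eventually:
  assumes "real_analytic_at f x" shows "\<forall>\<^sub>F t in nhds x. real_analytic_at f t"
proof -
  obtain F where F: "F analytic_on {complex_of_real x}"
    and e: "\<forall>\<^sub>F t in nhds x. complex_of_real (f t) = F (of_real t)"
    using assms unfolding real_analytic_at_def by blast
  obtain r where r: "r > 0" "F holomorphic_on ball (complex_of_real x) r"
    using F analytic_at_ball by blast
  have "F analytic_on {complex_of_real t}" if "t \<in> ball x r" for t
    using r that
      by (subst analytic_at) (auto simp: dist_real_def dist_complex_def simp flip: of_real_diff intro!: exI[of _ "ball (complex_of_real x) r"])
  then have "\<forall>\<^sub>F t in nhds x. F analytic_on {complex_of_real t}"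
    using r(1) by (metis (mono_tags, lifting) eventually_nhds centre_in_ball open_ball)
  moreover have "\<forall>\<^sub>F t in nhds x. \<forall>\<^sub>F s in nhds t. complex_of_real (f s) = F (of_real s)"
    using e by (simp add: eventually_eventually)
  ultimately show ?thesis by eventually_elim (auto simp: real_analytic_at_def)
qed

text \<open>The real part of \<open>F\<close> on the real axis is the restriction of \<open>(F + cnj \<circ> F \<circ> cnj) / 2\<close>.\<close>

lemma real_analytic_at_Re:
  assumes "F analytic_on {complex_of_real x}"
  shows "real_analytic_at (\<lambda>t. Re (F (of_real t))) x"
proof -
  define H where "H = cnj \<circ> F \<circ> cnj"
  define G where "G z = (F z + H z) / 2" for z
  obtain r where r: "r > 0" "F holomorphic_on ball (complex_of_real x) r"
    using assms analytic_at_ball by blast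
  have "cnj ` ball (complex_of_real x) r = ball (complex_of_real x) r"
  proof -
    have *: "dist (complex_of_real x) (cnj z) = dist (complex_of_real x) z" for z
      by (metis complex_cnj_complex_of_real complex_cnj_diff complex_mod_cnj dist_complex_def)
    show ?thesis by (force simp: * image_iff intro!: bexI[where x = "cnj _"])
  qed
  then have "H holomorphic_on ball (complex_of_real x) r"
    unfolding H_def using r by (intro holomorphic_on_compose_cnj_cnj) auto
  then have "G holomorphic_on ball (complex_of_real x) r"
    unfolding G_def
      using r by (intro holomorphic_on_divide holomorphic_on_add holomorphic_on_const) auto
  then have "G analytic_on {complex_of_real x}"
    using r(1) by (subst analytic_at) (metis centre_in_ball open_ball)
  moreover have "complex_of_real (Re (F (of_real t))) = G (of_real t)" for t
    by (simp add: G_def H_def complex_add_cnj)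
  ultimately show ?thesis unfolding real_analytic_at_def by (auto intro!: exI[of _ G])
qed

lemma lim_at_eq_0:
  fixes f :: "real \<Rightarrow> real"
  assumes "f \<midarrow>x\<rightarrow> l" "\<forall>\<^sub>F t in at x. f t = 0" shows "l = 0"
  using tendsto_unique[OF trivial_limit_at assms(1)] tendsto_eventually[OF assms(2)] by simp

text \<open>The holomorphic extension splits off a power of \<open>z - x\<close> at a zero of finite
  order; the real part of its cofactor is the wanted \<open>g\<close>.\<close>

lemma real_analytic_at_factor:
  assumes "real_analytic_at f x"
  shows "(\<forall>\<^sub>F t in nhds x. f t = 0) \<or>
    (\<exists>k g. real_analytic_at g x \<and> g x \<noteq> 0 \<and> (\<forall>\<^sub>F t in nhds x. f t = (t - x) ^ k * g t))"
proof -
  obtain F where F: "F analytic_on {complex_of_real x}"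
    and e: "\<forall>\<^sub>F t in nhds x. complex_of_real (f t) = F (of_real t)"
    using assms unfolding real_analytic_at_def by blast
  obtain r where r: "r > 0" "F holomorphic_on ball (complex_of_real x) r"
    using F analytic_at_ball by blast
  have Fx: "F (of_real x) = of_real (f x)" using eventually_nhds_x_imp_x[OF e] by simp
  show ?thesis
  proof (cases "f x = 0")
    case False
    then show ?thesis using assms by (intro disjI2 exI[of _ 0] exI[of _ f]) auto
  next
    case f0: True
    show ?thesis
    proof (cases "F constant_on ball (complex_of_real x) r")
      case True
      then have "F z = 0" if "z \<in> ball (complex_of_real x) r" for z
        using that Fx f0 r(1) unfolding constant_on_def by (metis centre_in_ball of_real_0)
      then have "\<forall>\<^sub>F z in nhds (complex_of_real x). F z = 0"
        using r(1) by (metis (mono_tags, lifting) eventually_nhds centre_in_ball open_ball)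
      from eventually_nhds_of_real[OF this] e have "\<forall>\<^sub>F t in nhds x. f t = 0"
        by eventually_elim auto
      then show ?thesis ..
    next
      case False
      obtain g s n where g: "0 < n" "0 < s"
            "g holomorphic_on ball (complex_of_real x) s"
            "\<And>w. w \<in> ball (complex_of_real x) s \<Longrightarrow> F w = (w - of_real x)^n * g w"
            "\<And>w. w \<in> ball (complex_of_real x) s \<Longrightarrow> g w \<noteq> 0"
        using holomorphic_factor_zero_nonconstant[OF r(2) open_ball connected_ball _ _ False] Fx
          f0 r(1)
        by (metis centre_in_ball of_real_0)
      have ga: "g analytic_on {complex_of_real x}"
        using g(2,3) by (subst analytic_at) (metis centre_in_ball open_ball)
      \<comment> \<open>\<open>h\<close> keeps only the real part of \<open>g\<close>, so
        \<open>g\<close> nonzero at \<open>x\<close> yields \<open>h x\<close> nonzero only if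
        \<open>g\<close> is real there. It is real at real \<open>t\<close> near \<open>x\<close>
        and different from \<open>x\<close>, because \<open>f t\<close> and \<open>(t - x)^n\<close>
        are; continuity gives \<open>x\<close> itself.\<close>
      define h where "h t = Re (g (of_real t))" for t
      have ah: "real_analytic_at h x" unfolding h_def by (rule real_analytic_at_Re[OF ga])
      have "\<forall>\<^sub>F z in nhds (complex_of_real x). F z = (z - of_real x)^n * g z"
        using g(2,4) by (metis (mono_tags, lifting) eventually_nhds centre_in_ball open_ball)
      from eventually_nhds_of_real[OF this] e
      have eq: "\<forall>\<^sub>F t in nhds x. complex_of_real (f t) = of_real ((t - x)^n) * g (of_real t)"
        by eventually_elim simp
      have fh: "\<forall>\<^sub>F t in nhds x. f t = (t - x)^n * h t"
        using eq
      proof eventually_elim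
        case (elim t)
        then have "Re (complex_of_real (f t)) = Re (of_real ((t - x)^n) * g (of_real t))"
          by (rule arg_cong)
        then show ?case unfolding h_def by (simp del: of_real_power of_real_diff)
      qed
      have "\<forall>\<^sub>F t in at x. Im (g (of_real t)) = 0"
        using eventually_nhds_imp_at[OF eq] eventually_neq_at_within[of x x UNIV]
      proof eventually_elim
        case (elim t)
        then have "Im (complex_of_real (f t)) = Im (of_real ((t - x)^n) * g (of_real t))" by simp
        with elim(2) show ?case by (simp del: of_real_power of_real_diff)
      qed
      moreover have "((\<lambda>t. Im (g (complex_of_real t))) \<longlongrightarrow> Im (g (of_real x))) (at x)"
        using isCont_Im[OF isCont_of_real_comp[OF analytic_at_imp_isCont[OF ga]]]
          unfolding isCont_def .
      ultimately have "Im (g (of_real x)) = 0" by (intro lim_at_eq_0)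
      moreover have "g (of_real x) \<noteq> 0" using g(2,5) by simp
      ultimately have "h x \<noteq> 0" by (simp add: h_def complex_eq_iff)
      with ah fh show ?thesis by blast
    qed
  qed
qed

text \<open>Continuity supplies the value at \<open>x\<close>. Identities obtained after division by
  a power of \<open>t - x\<close> hold only off \<open>x\<close>, and this extends them.\<close>

lemma real_analytic_at_zero_at:
  assumes "real_analytic_at f x" "\<forall>\<^sub>F t in at x. f t = 0" shows "\<forall>\<^sub>F t in nhds x. f t = 0"
proof -
  have "f \<midarrow>x\<rightarrow> f x" using real_analytic_at_isCont[OF assms(1)] by (simp add: isCont_def)
  then have "f x = 0" using assms(2) by (rule lim_at_eq_0)
  with assms(2) show ?thesis by (simp add: eventually_nhds_conv_at)
qed

text \<open>To the right of \<open>x\<close> the factor \<open>(t - x)^k\<close> is positive, so the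
  sign is that of the cofactor, which keeps the sign of its nonzero value at
  \<open>x\<close>.\<close>

lemma real_analytic_at_sign_right:
  assumes "real_analytic_at f x"
  shows "(\<forall>\<^sub>F t in at_right x. f t = 0) \<or> (\<forall>\<^sub>F t in at_right x. f t > 0) \<or> (\<forall>\<^sub>F t in at_right x. f t < 0)"
  using real_analytic_at_factor[OF assms]
proof
  assume "\<forall>\<^sub>F t in nhds x. f t = 0"
  then show ?thesis using eventually_nhds_imp_at by blast
next
  assume "\<exists>k g. real_analytic_at g x \<and> g x \<noteq> 0 \<and> (\<forall>\<^sub>F t in nhds x. f t = (t - x) ^ k * g t)"
  then obtain k g where g: "real_analytic_at g x" "g x \<noteq> 0"
    "\<forall>\<^sub>F t in at_right x. f t = (t - x) ^ k * g t"
    using eventually_nhds_imp_at by blast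
  have c: "(g \<longlongrightarrow> g x) (at_right x)"
    using real_analytic_at_isCont[OF g(1)] by (simp add: isCont_def filterlim_at_split)
  have p: "\<forall>\<^sub>F t in at_right x. t > x" by (simp add: eventually_at_right_less)
  show ?thesis
  proof (cases "g x > 0")
    case True
    have "\<forall>\<^sub>F t in at_right x. f t > 0"
      using order_tendstoD(1)[OF c True] g(3) p by eventually_elim simp
    then show ?thesis by blast
  next
    case False
    then have "g x < 0" using g(2) by simp
    from order_tendstoD(2)[OF c this] g(3) p
    have "\<forall>\<^sub>F t in at_right x. f t < 0" by eventually_elim (simp add: mult_pos_neg)
    then show ?thesis by blast
  qed
qed

lemma real_analytic_at_reflect:
  assumes "real_analytic_at f (-x)" shows "real_analytic_at (\<lambda>t. f (- t)) x"
proof -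
  obtain F where F: "F analytic_on {complex_of_real (-x)}"
    and e: "\<forall>\<^sub>F t in nhds (-x). complex_of_real (f t) = F (of_real t)"
    using assms unfolding real_analytic_at_def by blast
  have "(F \<circ> uminus) analytic_on {complex_of_real x}"
    using F by (intro analytic_on_compose) (auto intro!: analytic_intros)
  moreover have "filterlim uminus (nhds (-x)) (nhds x)"
    by (intro tendsto_intros filterlim_ident)
  then have "\<forall>\<^sub>F t in nhds x. complex_of_real (f (-t)) = F (of_real (-t))"
    using e by (auto simp: filterlim_iff)
  ultimately show ?thesis unfolding real_analytic_at_def by (auto intro!: exI[of _ "F \<circ> uminus"])
qed

text \<open>Reflection reduces this to the right side. The sides are kept apart because a zero of
  odd order changes the sign at \<open>x\<close>.\<close>

lemma real_analytic_at_sign_left: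
  assumes "real_analytic_at f x"
  shows "(\<forall>\<^sub>F t in at_left x. f t = 0) \<or> (\<forall>\<^sub>F t in at_left x. f t > 0) \<or> (\<forall>\<^sub>F t in at_left x. f t < 0)"
  using real_analytic_at_sign_right[of "\<lambda>t. f (-t)" "-x"] real_analytic_at_reflect[of f "-x"] assms
  by (simp add: at_left_minus eventually_filtermap)

section \<open>Vectors and matrices with analytic entries\<close>

definition vec_analytic_at :: "(real \<Rightarrow> real^'m) \<Rightarrow> real \<Rightarrow> bool" where
  "vec_analytic_at f x \<longleftrightarrow> (\<forall>i. real_analytic_at (\<lambda>t. f t $ i) x)"

definition mat_analytic_at :: "(real \<Rightarrow> real^'m^'n) \<Rightarrow> real \<Rightarrow> bool" where
  "mat_analytic_at f x \<longleftrightarrow> (\<forall>i j. real_analytic_at (\<lambda>t. f t $ i $ j) x)"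

lemma mat_analytic_at_mult:
  "mat_analytic_at X x \<Longrightarrow> mat_analytic_at Y x \<Longrightarrow> mat_analytic_at (\<lambda>t. X t ** Y t) x"
  by (auto simp: mat_analytic_at_def matrix_matrix_mult_def)
lemma mat_analytic_at_diff:
  "mat_analytic_at X x \<Longrightarrow> mat_analytic_at Y x \<Longrightarrow> mat_analytic_at (\<lambda>t. X t - Y t) x"
  by (auto simp: mat_analytic_at_def)
lemma mat_analytic_at_add:
  "mat_analytic_at X x \<Longrightarrow> mat_analytic_at Y x \<Longrightarrow> mat_analytic_at (\<lambda>t. X t + Y t) x"
  by (auto simp: mat_analytic_at_def)
lemma mat_analytic_at_scaleR:
  "real_analytic_at c x \<Longrightarrow> mat_analytic_at Y x \<Longrightarrow> mat_analytic_at (\<lambda>t. c t *\<^sub>R Y t) x"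
  by (auto simp: mat_analytic_at_def)
lemma mat_analytic_at_const: "mat_analytic_at (\<lambda>t. c) x" by (auto simp: mat_analytic_at_def)
lemma mat_analytic_at_sum:
  "(\<And>i. i \<in> S \<Longrightarrow> mat_analytic_at (f i) x) \<Longrightarrow> mat_analytic_at (\<lambda>t. \<Sum>i\<in>S. f i t) x"
  by (auto simp: mat_analytic_at_def)
lemma mat_analytic_at_transpose: "mat_analytic_at X x \<Longrightarrow> mat_analytic_at (\<lambda>t. transpose (X t)) x"
  by (auto simp: mat_analytic_at_def transpose_def)
lemma vec_analytic_at_mult:
  "mat_analytic_at X x \<Longrightarrow> vec_analytic_at y x \<Longrightarrow> vec_analytic_at (\<lambda>t. X t *v y t) x"
  by (auto simp: mat_analytic_at_def vec_analytic_at_def matrix_vector_mult_def)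
lemma vec_analytic_at_const: "vec_analytic_at (\<lambda>t. c) x" by (auto simp: vec_analytic_at_def)
lemma vec_analytic_at_scaleR:
  "real_analytic_at c x \<Longrightarrow> vec_analytic_at y x \<Longrightarrow> vec_analytic_at (\<lambda>t. c t *\<^sub>R y t) x"
  by (auto simp: vec_analytic_at_def)
lemma real_analytic_at_inner:
  "vec_analytic_at y x \<Longrightarrow> vec_analytic_at z x \<Longrightarrow> real_analytic_at (\<lambda>t. y t \<bullet> z t) x"
  by (auto simp: vec_analytic_at_def inner_vec_def)
lemma mat_analytic_at_zero_at:
  assumes "mat_analytic_at M x" "\<forall>\<^sub>F t in at x. M t = 0" shows "\<forall>\<^sub>F t in nhds x. M t = 0"
proof -
  have "\<forall>\<^sub>F t in at x. M t $ i $ j = 0" for i j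
    using assms(2) by eventually_elim simp
  with assms(1) have "\<forall>\<^sub>F t in nhds x. M t $ i $ j = 0" for i j
    unfolding mat_analytic_at_def using real_analytic_at_zero_at by blast
  then have "\<forall>\<^sub>F t in nhds x. \<forall>i\<in>UNIV. \<forall>j\<in>UNIV. M t $ i $ j = 0"
    by (intro eventually_ball_finite ballI finite)
  then show ?thesis by eventually_elim (simp add: vec_eq_iff)
qed

text \<open>The least order of vanishing among the entries that are not identically zero is split
  off; the entry attaining it keeps \<open>C\<close> nonzero at \<open>x\<close>.\<close>

lemma mat_analytic_at_factor:
  assumes "mat_analytic_at M x" "\<not> (\<forall>\<^sub>F t in nhds x. M t = 0)"
  shows "\<exists>k C. mat_analytic_at C x \<and> C x \<noteq> 0 \<and> (\<forall>\<^sub>F t in nhds x. M t = (t - x) ^ k *\<^sub>R C t)"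
proof -
  define N where "N p \<longleftrightarrow> \<not> (\<forall>\<^sub>F t in nhds x. M t $ fst p $ snd p = 0)" for p
  have "\<forall>p. \<exists>q. N p \<longrightarrow> real_analytic_at (snd q) x \<and> snd q x \<noteq> 0 \<and>
      (\<forall>\<^sub>F t in nhds x. M t $ fst p $ snd p = (t - x) ^ fst q * snd q t)"
    using real_analytic_at_factor[of "\<lambda>t. M t $ fst p $ snd p" x for p] assms(1)
      unfolding N_def mat_analytic_at_def by force
  then obtain q where q: "\<forall>p. N p \<longrightarrow> real_analytic_at (snd (q p)) x \<and> snd (q p) x \<noteq> 0 \<and>
      (\<forall>\<^sub>F t in nhds x. M t $ fst p $ snd p = (t - x) ^ fst (q p) * snd (q p) t)"
    by (rule exE[OF choice])
  define k g where "k p = fst (q p)" and "g p = snd (q p)" for p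
  have kg: "\<And>p. N p \<Longrightarrow> real_analytic_at (g p) x"  "\<And>p. N p \<Longrightarrow> g p x \<noteq> 0"
    "\<And>p. N p \<Longrightarrow> \<forall>\<^sub>F t in nhds x. M t $ fst p $ snd p = (t - x) ^ k p * g p t"
    using q unfolding k_def g_def by blast+
  have "\<exists>p. N p"
  proof (rule ccontr)
    assume "\<nexists>p. N p"
    then have "\<forall>\<^sub>F t in nhds x. \<forall>i\<in>UNIV. \<forall>j\<in>UNIV. M t $ i $ j = 0"
      by (intro eventually_ball_finite ballI finite) (auto simp: N_def)
    then have "\<forall>\<^sub>F t in nhds x. M t = 0" by eventually_elim (simp add: vec_eq_iff)
    with assms(2) show False by simp
  qed
  then obtain p0 where p0: "N p0" "\<And>p. N p \<Longrightarrow> k p0 \<le> k p"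
    using ex_has_least_nat[of N _ k] by metis
  \<comment> \<open>The natural subtraction of exponents is exact because \<open>k p0\<close> is
    least. Identically vanishing entries have no order and receive 0.\<close>
  define C where "C t = (\<chi> i j. if N (i, j) then (t - x) ^ (k (i,j) - k p0) * g (i,j) t else 0)" for t
  have "mat_analytic_at C x"
    unfolding mat_analytic_at_def
  proof (intro allI)
    fix i j
    show "real_analytic_at (\<lambda>t. C t $ i $ j) x"
      using kg(1)[of "(i, j)"] by (cases "N (i, j)") (auto simp: C_def)
  qed
  moreover have "C x $ fst p0 $ snd p0 \<noteq> 0" using p0 kg(2) by (auto simp: C_def)
  then have "C x \<noteq> 0" by auto
  moreover have "\<forall>\<^sub>F t in nhds x. \<forall>i\<in>UNIV. \<forall>j\<in>UNIV. M t $ i $ j = (t - x) ^ k p0 * C t $ i $ j"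
  proof (intro eventually_ball_finite ballI finite)
    fix i j
    show "\<forall>\<^sub>F t in nhds x. M t $ i $ j = (t - x) ^ k p0 * C t $ i $ j"
    proof (cases "N (i,j)")
      case True
      then have "k p0 \<le> k (i,j)" using p0 by blast
      then show ?thesis
        using kg(3)[OF True] True
          by (auto simp: C_def power_add[symmetric] elim!: eventually_mono simp flip: mult.assoc)
    next
      case False
      then show ?thesis by (auto simp: N_def C_def)
    qed
  qed
  then have "\<forall>\<^sub>F t in nhds x. M t = (t - x) ^ k p0 *\<^sub>R C t"
    by eventually_elim (simp add: vec_eq_iff)
  ultimately show ?thesis by blast
qed

section \<open>Analytic families of idempotents\<close>

text \<open>This is \<open>3 X^2 - 2 X^3\<close>, the cubic that fixes 0 and 1 and has derivative 0
  at both. Stated over a commutative ring, it serves real and complex matrices alike.\<close>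

definition purify :: "'a::comm_ring_1^'m^'m \<Rightarrow> 'a^'m^'m" where
  "purify X = X ** X + X ** X + X ** X - (X ** X ** X + X ** X ** X)"

lemma matrix_add_rdistrib: "(A + B) ** C = A ** C + B ** (C :: 'a::comm_ring_1^'m^'n)"
  by (simp add: matrix_matrix_mult_def vec_eq_iff algebra_simps sum.distrib)

lemma matrix_diff_ldistrib: "A ** (B - C) = A ** B - A ** (C :: 'a::comm_ring_1^'m^'n)"
  by (simp add: matrix_matrix_mult_def vec_eq_iff algebra_simps sum_subtractf)

lemma matrix_diff_rdistrib: "(A - B) ** C = A ** C - B ** (C :: 'a::comm_ring_1^'m^'n)"
  by (simp add: matrix_matrix_mult_def vec_eq_iff algebra_simps sum_subtractf)

lemmas matrix_ring_simps = matrix_add_ldistrib matrix_add_rdistrib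
  matrix_diff_ldistrib matrix_diff_rdistrib matrix_mul_assoc

text \<open>For the scalar cubic \<open>p\<close> and \<open>d = x^2 - x\<close> one has
  \<open>p^2 - p = 4 d^3 - 3 d^2\<close>. The new defect is thus quadratic in the old one, which
  drives the convergence.\<close>

lemma purify_defect:
  fixes X :: "'a::comm_ring_1^'m^'m"
  defines "D \<equiv> X ** X - X"
  shows "purify X ** purify X - purify X =
    (D ** D ** D + D ** D ** D + D ** D ** D + D ** D ** D) - (D ** D + D ** D + D ** D)"
  unfolding purify_def D_def by (simp only: matrix_ring_simps) (simp add: algebra_simps)

lemma purify_step:
  fixes X :: "'a::comm_ring_1^'m^'m"
  defines "D \<equiv> X ** X - X"
  shows "purify X - X = D - (X ** D + X ** D)"
  unfolding purify_def D_def by (simp only: matrix_ring_simps) (simp add: algebra_simps)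

lemma purify_idem: "X ** X = X \<Longrightarrow> purify X = X"
  by (simp add: purify_def)

lemma norm_matrix_mult_le:
  fixes X Y :: "'a::real_normed_field^'m^'m"
  shows "norm (X ** Y) \<le> norm X * norm Y"
proof -
  have row: "norm ((X ** Y) $ i) \<le> norm (X $ i) * norm Y" for i
  proof -
    have "(X ** Y) $ i = (\<Sum>k\<in>UNIV. X $ i $ k *s Y $ k)"
      by (simp add: vec_eq_iff matrix_matrix_mult_def)
    then have "norm ((X ** Y) $ i) \<le> (\<Sum>k\<in>UNIV. norm (X $ i $ k *s Y $ k))"
      by (simp add: norm_sum)
    also have "\<dots> = (\<Sum>k\<in>UNIV. \<bar>norm (X $ i $ k)\<bar> * \<bar>norm (Y $ k)\<bar>)"
      by (simp add: norm_vec_def norm_mult L2_set_right_distrib)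
    also have "\<dots> \<le> norm (X $ i) * norm Y"
      using L2_set_mult_ineq[of "\<lambda>k. norm (X $ i $ k)" "\<lambda>k. norm (Y $ k)" UNIV]
      by (simp add: norm_vec_def)
    finally show ?thesis .
  qed
  have "norm (X ** Y) = L2_set (\<lambda>i. norm ((X ** Y) $ i)) UNIV"
    by (rule norm_vec_def)
  also have "\<dots> \<le> L2_set (\<lambda>i. norm (X $ i) * norm Y) UNIV"
    by (intro L2_set_mono row) simp
  also have "\<dots> = norm X * norm Y"
    by (simp add: L2_set_left_distrib[symmetric] norm_vec_def[of X])
  finally show ?thesis .
qed

text \<open>The defect at least halves in each step, so that the product of the growth factors stays
  below 3.\<close>

lemma purify_estimates:
  fixes X :: "'a::real_normed_field^'m^'m"
  assumes "norm (X ** X - X) \<le> 1/8"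
  defines "Y \<equiv> \<lambda>k. (purify ^^ k) X"
  shows "norm (Y k ** Y k - Y k) \<le> (1/2)^k / 8 \<and> 1 + norm (Y k) \<le> (1 + norm X) * (3 - 2 * (1/2)^k)"
    and "norm (Y (Suc k) - Y k) \<le> (1 + norm X) * (1/2)^k"
proof -
  have step: "norm (purify Z - Z) \<le> norm (Z ** Z - Z) * (1 + 2 * norm Z)" for Z :: "'a^'m^'m"
  proof -
    define D where "D = Z ** Z - Z"
    have "norm (D - (Z ** D + Z ** D)) \<le> norm D + (norm Z * norm D + norm Z * norm D)"
      by (intro norm_triangle_le_diff norm_triangle_le add_mono norm_matrix_mult_le order_refl)
    then show ?thesis by (simp add: purify_step D_def algebra_simps)
  qed
  have defect: "norm (purify Z ** purify Z - purify Z) \<le> norm (Z ** Z - Z) / 2"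
    if "norm (Z ** Z - Z) \<le> 1/8" for Z :: "'a^'m^'m"
  proof -
    define D where "D = Z ** Z - Z"
    define \<delta> where "\<delta> = norm D"
    have d: "0 \<le> \<delta>" "\<delta> \<le> 1/8" using that by (auto simp: D_def \<delta>_def)
    have 2: "norm (D ** D) \<le> \<delta> * \<delta>" unfolding \<delta>_def by (rule norm_matrix_mult_le)
    have "norm (D ** D ** D) \<le> norm (D ** D) * norm D" by (rule norm_matrix_mult_le)
    also have "\<dots> \<le> \<delta> * \<delta> * \<delta>" using 2 unfolding \<delta>_def by (intro mult_right_mono) auto
    finally have 3: "norm (D ** D ** D) \<le> \<delta> * \<delta> * \<delta>" .
    have "norm (purify Z ** purify Z - purify Z) \<le> (\<delta>*\<delta>*\<delta> + \<delta>*\<delta>*\<delta> + \<delta>*\<delta>*\<delta> + \<delta>*\<delta>*\<delta>) + (\<delta>*\<delta> + \<delta>*\<delta> + \<delta>*\<delta>)"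
      unfolding purify_defect D_def[symmetric]
      by (intro norm_triangle_le_diff norm_triangle_le add_mono 2 3)
    also have "\<dots> = \<delta> * (\<delta> * (4 * \<delta> + 3))" by (simp add: algebra_simps)
    \<comment> \<open>For \<open>\<delta> \<le> 1/8\<close> the factor multiplying the outer
      \<open>\<delta>\<close> is at most 7/16, so the threshold 1/8 is small enough for
      halving.\<close>
    also have "\<dots> \<le> \<delta> * (1/8 * (4 * (1/8) + 3))" using d by (intro mult_left_mono mult_mono) auto
    also have "\<dots> \<le> \<delta> / 2" using d by simp
    finally show ?thesis by (simp add: \<delta>_def D_def)
  qed
  have main: "norm (Y k ** Y k - Y k) \<le> (1/2)^k / 8 \<and> 1 + norm (Y k) \<le> (1 + norm X) * (3 - 2 * (1/2)^k)" for k
  proof (induction k)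
    case 0
    then show ?case using assms(1) by (simp add: Y_def)
  next
    case (Suc k)
    define e :: real where "e = (1/2)^k"
    have e: "0 < e" "e \<le> 1" by (auto simp: e_def power_le_one)
    have YS: "Y (Suc k) = purify (Y k)" by (simp add: Y_def)
    have D: "norm (Y k ** Y k - Y k) \<le> e / 8" and B: "1 + norm (Y k) \<le> (1 + norm X) * (3 - 2 * e)"
      using Suc by (auto simp: e_def)
    have "norm (Y (Suc k) ** Y (Suc k) - Y (Suc k)) \<le> (e/8) / 2"
      unfolding YS using defect[of "Y k"] D e by simp
    moreover have "1 + norm (Y (Suc k)) \<le> (1 + norm X) * (3 - e)"
    proof -
      have "norm (Y (Suc k)) \<le> norm (Y k) + norm (purify (Y k) - Y k)"
        unfolding YS using norm_triangle_ineq[of "Y k" "purify (Y k) - Y k"] by simp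
      also have "\<dots> \<le> norm (Y k) + e / 8 * (1 + 2 * norm (Y k))"
        using D by (intro add_left_mono order_trans[OF step] mult_right_mono) auto
      finally have "1 + norm (Y (Suc k)) \<le> (1 + norm (Y k)) * (1 + e/4)"
        using e by (simp add: field_simps)
      also have "\<dots> \<le> ((1 + norm X) * (3 - 2 * e)) * (1 + e/4)"
        using B e by (intro mult_right_mono) auto
      also have "\<dots> = (1 + norm X) * ((3 - 2 * e) * (1 + e/4))" by simp
      \<comment> \<open>The product is \<open>3 - 5*e/4 - e^2/2\<close>. Since \<open>e\<close> is
        halved in the next step, \<open>3 - e\<close> is the next value of the bound
        \<open>3 - 2 * e\<close>.\<close>
      also have "(3 - 2 * e) * (1 + e/4) \<le> 3 - e"
        using e by (simp add: field_simps)
      then have "(1 + norm X) * ((3 - 2 * e) * (1 + e/4)) \<le> (1 + norm X) * (3 - e)"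
        by (intro mult_left_mono) auto
      finally show ?thesis .
    qed
    ultimately show ?case by (simp add: e_def)
  qed
  from main show "norm (Y k ** Y k - Y k) \<le> (1/2)^k / 8 \<and> 1 + norm (Y k) \<le> (1 + norm X) * (3 - 2 * (1/2)^k)" .
  define e :: real where "e = (1/2)^k"
  have e: "0 < e" "e \<le> 1" by (auto simp: e_def power_le_one)
  have D: "norm (Y k ** Y k - Y k) \<le> e / 8" and B: "1 + norm (Y k) \<le> (1 + norm X) * (3 - 2 * e)"
    using main[of k] by (auto simp: e_def)
  have B3: "1 + norm (Y k) \<le> (1 + norm X) * 3"
    by (rule order_trans[OF B]) (use e in \<open>intro mult_left_mono, auto\<close>)
  have "norm (Y (Suc k) - Y k) \<le> norm (Y k ** Y k - Y k) * (1 + 2 * norm (Y k))"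
    using step[of "Y k"] by (simp add: Y_def)
  also have "\<dots> \<le> e / 8 * (2 * ((1 + norm X) * 3))"
    using D B3 e by (intro mult_mono) auto
  also have "\<dots> \<le> (1 + norm X) * e" using e by (simp add: field_simps)
  finally show "norm (Y (Suc k) - Y k) \<le> (1 + norm X) * (1/2)^k" by (simp add: e_def)
qed

section \<open>Complexification and the limit of the iteration\<close>

definition complexify :: "real^'m^'m \<Rightarrow> complex^'m^'m" where
  "complexify X = (\<chi> i j. of_real (X $ i $ j))"

lemma complexify_mult: "complexify (X ** Y) = complexify X ** complexify Y"
  by (simp add: complexify_def matrix_matrix_mult_def vec_eq_iff)

lemma complexify_purify:
  fixes X :: "real^'m^'m"
  shows "complexify (purify X) = purify (complexify X)"
proof -
  have "complexify (A + B) = complexify A + complexify B"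
    "complexify (A - B) = complexify A - complexify B" for A B :: "real^'m^'m"
    by (simp_all add: complexify_def vec_eq_iff)
  then show ?thesis unfolding purify_def by (simp only: complexify_mult)
qed

lemma complexify_purify_iter: "complexify ((purify ^^ k) X) = (purify ^^ k) (complexify X)"
  by (induction k) (auto simp: complexify_purify)

lemma tendsto_matrix_mult:
  fixes X Y :: "'b \<Rightarrow> 'a::real_normed_field^'m^'m"
  assumes "(X \<longlongrightarrow> L) F" "(Y \<longlongrightarrow> M) F"
  shows "((\<lambda>t. X t ** Y t) \<longlongrightarrow> L ** M) F"
  unfolding matrix_matrix_mult_def
  by (intro vec_tendstoI) (auto intro!: tendsto_intros assms)

lemma mat_analytic_at_isCont:
  assumes "mat_analytic_at X x" shows "isCont X x"
  unfolding isCont_def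
proof (intro vec_tendstoI)
  fix i j
  have "real_analytic_at (\<lambda>t. X t $ i $ j) x" using assms unfolding mat_analytic_at_def by blast
  from real_analytic_at_isCont[OF this] show "((\<lambda>t. X t $ i $ j) \<longlongrightarrow> X x $ i $ j) (at x)"
    unfolding isCont_def .
qed

lemma eventually_analytic_at:
  assumes "F analytic_on {z}" shows "\<forall>\<^sub>F w in nhds z. F analytic_on {w}"
proof -
  obtain S where S: "open S" "z \<in> S" "F holomorphic_on S"
    using assms by (auto simp: analytic_at)
  then have "F analytic_on {w}" if "w \<in> S" for w
    using that by (auto simp: analytic_at)
  with S show ?thesis unfolding eventually_nhds by blast
qed

text \<open>On a complex neighbourhood the initial defect is below 1/8, the iterates are holomorphic
  and their increments are dominated by a geometric series. The uniform limit is therefore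
  holomorphic, and its real part on the axis is \<open>Q\<close>. The iteration fixes the idempotent
  \<open>X x\<close>. Convergence belongs to the conclusion so that closed algebraic relations can
  be passed from \<open>X\<close> to \<open>Q\<close>.\<close>

lemma mat_analytic_at_purify_limit:
  fixes X :: "real \<Rightarrow> real^'m^'m"
  assumes X: "mat_analytic_at X x" and idem: "X x ** X x = X x"
  shows "\<exists>Q. mat_analytic_at Q x \<and> Q x = X x \<and>
    (\<forall>\<^sub>F t in nhds x. Q t ** Q t = Q t \<and> (\<lambda>k. (purify ^^ k) (X t)) \<longlonglongrightarrow> Q t)"
proof -
  let ?x = "complex_of_real x"
  have "\<forall>p. \<exists>F. F analytic_on {?x} \<and>
      (\<forall>\<^sub>F t in nhds x. complex_of_real (X t $ fst p $ snd p) = F (of_real t))"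
    using X unfolding mat_analytic_at_def real_analytic_at_def by blast
  then obtain F where F: "\<forall>p. F p analytic_on {?x} \<and>
      (\<forall>\<^sub>F t in nhds x. complex_of_real (X t $ fst p $ snd p) = F p (of_real t))"
    by (rule exE[OF choice])
  define Z where "Z z = (\<chi> i j. F (i, j) z)" for z
  define Y where "Y k z = (purify ^^ k) (Z z)" for k z
  have eqZ: "\<forall>\<^sub>F t in nhds x. Z (of_real t) = complexify (X t)"
  proof -
    have "\<forall>\<^sub>F t in nhds x. \<forall>p\<in>UNIV. complex_of_real (X t $ fst p $ snd p) = F p (of_real t)"
      using F by (intro eventually_ball_finite ballI finite) auto
    then show ?thesis by eventually_elim (auto simp: Z_def complexify_def vec_eq_iff)
  qed
  have Zx: "Z ?x = complexify (X x)" using eventually_nhds_x_imp_x[OF eqZ] by simp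
  have Zc: "(Z \<longlongrightarrow> Z ?x) (nhds ?x)"
    unfolding Z_def
  proof (intro vec_tendstoI)
    fix i j
    have "isCont (F (i,j)) ?x" using F analytic_at_imp_isCont by blast
    then show "((\<lambda>z. (\<chi> i j. F (i, j) z) $ i $ j) \<longlongrightarrow> (\<chi> i j. F (i, j) ?x) $ i $ j) (nhds ?x)"
      by (simp add: isCont_def tendsto_at_iff_tendsto_nhds)
  qed
  have "((\<lambda>z. norm (Z z ** Z z - Z z)) \<longlongrightarrow> norm (Z ?x ** Z ?x - Z ?x)) (nhds ?x)"
    by (intro tendsto_norm tendsto_diff tendsto_matrix_mult Zc)
  moreover have "Z ?x ** Z ?x = Z ?x" using idem by (simp add: Zx flip: complexify_mult)
  ultimately have e1: "\<forall>\<^sub>F z in nhds ?x. norm (Z z ** Z z - Z z) < 1/8"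
    by (intro order_tendstoD(2)) auto
  have e2: "\<forall>\<^sub>F z in nhds ?x. norm (Z z) < norm (Z ?x) + 1"
    using tendsto_norm[OF Zc] by (intro order_tendstoD(2)) auto
  have e3: "\<forall>\<^sub>F z in nhds ?x. \<forall>p\<in>UNIV. F p analytic_on {z}"
    using F by (intro eventually_ball_finite ballI finite)
      (auto intro: eventually_analytic_at)
  have "\<forall>\<^sub>F z in nhds ?x. norm (Z z ** Z z - Z z) < 1/8 \<and> norm (Z z) < norm (Z ?x) + 1 \<and>
      (\<forall>p. F p analytic_on {z})"
    using e1 e2 e3 by eventually_elim auto
  then obtain U where U: "open U" "?x \<in> U" and
    small: "\<And>z. z \<in> U \<Longrightarrow> norm (Z z ** Z z - Z z) < 1/8" and
    bnd: "\<And>z. z \<in> U \<Longrightarrow> norm (Z z) < norm (Z ?x) + 1" and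
    hol: "\<And>p z. z \<in> U \<Longrightarrow> F p analytic_on {z}"
    unfolding eventually_nhds by blast
  have holF: "F p holomorphic_on U" for p
    using hol by (metis analytic_imp_holomorphic analytic_on_analytic_at)
  have holY: "(\<lambda>z. Y k z $ i $ j) holomorphic_on U" for k i j
  proof (induction k arbitrary: i j)
    case 0
    then show ?case using holF by (simp add: Y_def Z_def)
  next
    case (Suc k)
    have "Y (Suc k) z = purify (Y k z)" for z by (simp add: Y_def)
    then show ?case
      by (simp add: purify_def matrix_matrix_mult_def)
        (intro holomorphic_intros holomorphic_on_sum Suc)
  qed
  define M where "M = 2 + norm (Z ?x)"
  \<comment> \<open>The limit of the iterates is written as a telescoping series, so that the
    Weierstrass test applies on \<open>U\<close>, where \<open>M\<close> bounds
    \<open>1 + norm (Z z)\<close>.\<close>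
  define S where "S i j z = (\<Sum>k. (Y (Suc k) z - Y k z) $ i $ j)" for i j z
  have ul: "uniform_limit U (\<lambda>n z. \<Sum>k<n. (Y (Suc k) z - Y k z) $ i $ j) (S i j) sequentially" for i j
    unfolding S_def
  proof (rule Weierstrass_m_test)
    fix k z assume z: "z \<in> U"
    have "norm ((Y (Suc k) z - Y k z) $ i $ j) \<le> norm ((Y (Suc k) z - Y k z))"
      by (rule order_trans[OF Finite_Cartesian_Product.norm_nth_le
        Finite_Cartesian_Product.norm_nth_le])
    also have "\<dots> \<le> (1 + norm (Z z)) * (1/2)^k"
      unfolding Y_def using small[OF z] by (intro purify_estimates(2)) simp
    also have "\<dots> \<le> M * (1/2)^k"
      unfolding M_def using bnd[OF z] by (intro mult_right_mono) auto
    finally show "norm ((Y (Suc k) z - Y k z) $ i $ j) \<le> M * (1/2)^k" .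
  next
    show "summable (\<lambda>k. M * (1/2)^k)" by (intro summable_mult summable_geometric) simp
  qed
  define L where "L i j z = S i j z + Y 0 z $ i $ j" for i j z
  have tele: "(\<Sum>k<n. (Y (Suc k) z - Y k z) $ i $ j) = Y n z $ i $ j - Y 0 z $ i $ j" for n z i j
    using sum_lessThan_telescope[of "\<lambda>k. Y k z $ i $ j" n] by simp
  have ulY: "uniform_limit U (\<lambda>n z. Y n z $ i $ j) (L i j) sequentially" for i j
    using uniform_limit_add[OF ul uniform_limit_const, of i j "\<lambda>z. Y 0 z $ i $ j"]
    by (simp only: tele L_def[abs_def] diff_add_cancel)
  have holL: "L i j holomorphic_on U" for i j
  proof (rule holomorphic_uniform_sequence[OF U(1) holY])
    fix z assume "z \<in> U"
    then obtain d where "d > 0" "cball z d \<subseteq> U" using U(1) open_contains_cball by blast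
    then show "\<exists>d. 0 < d \<and> cball z d \<subseteq> U \<and> uniform_limit (cball z d) (\<lambda>n z. Y n z $ i $ j) (L i j) sequentially"
      using uniform_limit_on_subset[OF ulY] by blast
  qed
  define Q where "Q t = (\<chi> i j. Re (L i j (of_real t)))" for t
  have "L i j analytic_on {?x}" for i j
    using holL U by (subst analytic_at) blast
  then have "mat_analytic_at Q x"
    by (auto simp: mat_analytic_at_def Q_def intro: real_analytic_at_Re)
  have lim: "\<forall>\<^sub>F t in nhds x. (\<lambda>k. (purify ^^ k) (X t)) \<longlonglongrightarrow> Q t"
  proof -
    have "\<forall>\<^sub>F z in nhds ?x. z \<in> U" using U eventually_nhds by blast
    from eventually_nhds_of_real[OF this] eqZ show ?thesis
    proof eventually_elim
      case (elim t)
      show ?case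
      proof (intro vec_tendstoI)
        fix i j
        have "(\<lambda>n. Re (Y n (of_real t) $ i $ j)) \<longlonglongrightarrow> Re (L i j (of_real t))"
          using tendsto_uniform_limitI[OF ulY elim(1)] by (rule tendsto_Re)
        moreover have "Re (Y n (of_real t) $ i $ j) = (purify ^^ n) (X t) $ i $ j" for n
          unfolding Y_def elim(2) complexify_purify_iter[symmetric] by (simp add: complexify_def)
        ultimately show "(\<lambda>n. (purify ^^ n) (X t) $ i $ j) \<longlonglongrightarrow> Q t $ i $ j" by (simp add: Q_def)
      qed
    qed
  qed
  have Xc: "(X \<longlongrightarrow> X x) (nhds x)"
    using mat_analytic_at_isCont[OF X] by (simp add: isCont_def tendsto_at_iff_tendsto_nhds)
  have "((\<lambda>t. norm (X t ** X t - X t)) \<longlongrightarrow> norm (X x ** X x - X x)) (nhds x)"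
    by (intro tendsto_norm tendsto_diff tendsto_matrix_mult Xc)
  then have "\<forall>\<^sub>F t in nhds x. norm (X t ** X t - X t) < 1/8"
    using idem by (intro order_tendstoD(2)) auto
  with lim have "\<forall>\<^sub>F t in nhds x. Q t ** Q t = Q t \<and> (\<lambda>k. (purify ^^ k) (X t)) \<longlonglongrightarrow> Q t"
  proof eventually_elim
    case (elim t)
    let ?P = "\<lambda>k. (purify ^^ k) (X t)"
    have "(\<lambda>k. ?P k ** ?P k - ?P k) \<longlonglongrightarrow> Q t ** Q t - Q t"
      by (intro tendsto_diff tendsto_matrix_mult elim)
    moreover have "(\<lambda>k. ?P k ** ?P k - ?P k) \<longlonglongrightarrow> 0"
    proof (rule Lim_null_comparison)
      show "\<forall>\<^sub>F k in sequentially. norm (?P k ** ?P k - ?P k) \<le> (1/2)^k / 8"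
        using purify_estimates(1)[of "X t"] elim by auto
      show "(\<lambda>k. (1/2)^k / 8 :: real) \<longlonglongrightarrow> 0"
        by (intro tendsto_divide_zero LIMSEQ_power_zero) simp
    qed
    ultimately have "Q t ** Q t - Q t = 0" by (rule LIMSEQ_unique)
    with elim show ?case by simp
  qed
  moreover have "Q x = X x"
  proof -
    have "(purify ^^ k) (X x) = X x" for k by (induction k) (auto simp: purify_idem[OF idem])
    then have "(\<lambda>k. X x) \<longlonglongrightarrow> Q x" using eventually_nhds_x_imp_x[OF lim] by simp
    then show ?thesis by (simp add: LIMSEQ_const_iff)
  qed
  ultimately show ?thesis using \<open>mat_analytic_at Q x\<close> by blast
qed

section \<open>Self-adjoint matrices\<close>

text \<open>For symmetric positive definite \<open>A\<close> this is self-adjointness of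
  \<open>B\<close> in the inner product given by \<open>A\<close>. As a linear matrix equation in
  \<open>B\<close> it survives limits and division by powers of \<open>t - x\<close>.\<close>

definition selfadjoint :: "real^'m^'m \<Rightarrow> real^'m^'m \<Rightarrow> bool" where
  "selfadjoint A B \<longleftrightarrow> transpose (A ** B) = A ** B"

lemma selfadjoint_inner:
  assumes "transpose A = A" "selfadjoint A B"
  shows "x \<bullet> (A *v (B *v y)) = (B *v x) \<bullet> (A *v y)"
proof -
  have "x \<bullet> (A *v (B *v y)) = (transpose (A ** B) *v x) \<bullet> y"
    by (simp add: matrix_vector_mul_assoc transpose_matrix_vector dot_lmul_matrix)
  also have "\<dots> = (transpose A *v (B *v x)) \<bullet> y"
    using assms by (simp add: selfadjoint_def matrix_vector_mul_assoc)
  also have "\<dots> = (B *v x) \<bullet> (A *v y)"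
    by (simp add: transpose_matrix_vector dot_lmul_matrix)
  finally show ?thesis .
qed

lemma selfadjointI:
  assumes "\<And>x y. x \<bullet> (A *v (B *v y)) = (A *v (B *v x)) \<bullet> y"
  shows "selfadjoint A B"
proof -
  have "x \<bullet> ((A ** B) *v y) = x \<bullet> (transpose (A ** B) *v y)" for x y
    using assms[of x y]
    by (metis matrix_vector_mul_assoc dot_lmul_matrix transpose_matrix_vector transpose_transpose)
  then have "(A ** B) *v y = transpose (A ** B) *v y" for y
    by (metis vector_eq_rdot inner_commute)
  then show ?thesis unfolding selfadjoint_def by (metis matrix_eq)
qed

lemma selfadjoint_mult:
  assumes "transpose A = A" "selfadjoint A X" "selfadjoint A Y" "X ** Y = Y ** X"
  shows "selfadjoint A (X ** Y)"
proof -
  have X: "transpose X ** A = A ** X" and Y: "transpose Y ** A = A ** Y"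
    using assms(1-3) unfolding selfadjoint_def matrix_transpose_mul by auto
  have "transpose (A ** (X ** Y)) = transpose Y ** (transpose X ** A)"
    using assms(1) by (simp add: matrix_transpose_mul matrix_mul_assoc)
  also have "\<dots> = A ** (X ** Y)"
    using assms(4) by (metis X Y matrix_mul_assoc)
  finally show ?thesis unfolding selfadjoint_def .
qed

lemma transpose_diff: "transpose (X - Y) = transpose X - transpose (Y :: real^'m^'n)"
  by (simp add: transpose_def vec_eq_iff)
lemma transpose_add: "transpose (X + Y) = transpose X + transpose (Y :: real^'m^'n)"
  by (simp add: transpose_def vec_eq_iff)
lemma transpose_scaleR: "transpose (c *\<^sub>R X) = c *\<^sub>R transpose (X :: real^'m^'n)"
  by (simp add: transpose_def vec_eq_iff)

lemma matrix_scaleR_right: "A ** (k *\<^sub>R B) = k *\<^sub>R (A ** (B :: real^'m^'n))"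
  by (simp add: matrix_matrix_mult_def vec_eq_iff sum_distrib_left mult_ac)
lemma matrix_scaleR_left: "(k *\<^sub>R A) ** B = k *\<^sub>R (A ** (B :: real^'m^'n))"
  by (simp add: matrix_matrix_mult_def vec_eq_iff sum_distrib_left mult_ac)

lemma selfadjoint_diff: "selfadjoint A X \<Longrightarrow> selfadjoint A Y \<Longrightarrow> selfadjoint A (X - Y)"
  by (simp add: selfadjoint_def matrix_diff_ldistrib transpose_diff)
lemma selfadjoint_add: "selfadjoint A X \<Longrightarrow> selfadjoint A Y \<Longrightarrow> selfadjoint A (X + Y)"
  by (simp add: selfadjoint_def matrix_add_ldistrib transpose_add)
lemma selfadjoint_scaleR: "selfadjoint A X \<Longrightarrow> selfadjoint A (c *\<^sub>R X)"
  by (simp add: selfadjoint_def matrix_scaleR_right transpose_scaleR)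
lemma selfadjoint_mat1: "transpose A = A \<Longrightarrow> selfadjoint A (mat 1)"
  by (simp add: selfadjoint_def)

text \<open>A nonnegative parabola through the origin has no linear term there. The test point is
  \<open>s = c/g\<close>, where \<open>g\<close> exceeds \<open>h\<close> and is positive even if
  \<open>h\<close> is not.\<close>

lemma quadratic_form_zero:
  fixes c h :: real
  assumes "0 \<le> c" "\<And>s. 0 \<le> s * s * h - 2 * s * c" shows "c = 0"
proof (rule ccontr)
  assume "c \<noteq> 0"
  with assms(1) have c: "c > 0" by simp
  define g where "g = \<bar>h\<bar> + 1"
  have g: "g > 0" "h < g" by (auto simp: g_def)
  have "0 \<le> (c/g) * (c/g) * h - 2 * (c/g) * c" by (rule assms)
  also have "\<dots> \<le> (c/g) * (c/g) * g - 2 * (c/g) * c"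
    using g by (intro diff_right_mono mult_left_mono) auto
  also have "\<dots> = - (c * c / g)" using g by (simp add: field_simps)
  also have "\<dots> < 0" using c g by simp
  finally show False by simp
qed

text \<open>The eigenvector maximizes the Rayleigh quotient \<open>q\<close> on \<open>W\<close>.
  Since \<open>q\<close> is homogeneous of degree 0, the maximum may be sought on the Euclidean unit
  sphere although the inner product comes from \<open>A\<close>.\<close>

lemma selfadjoint_eigenvector:
  assumes pd: "positive_definite A" and sa: "selfadjoint A B"
    and W: "subspace W" "W \<noteq> {0}" and inv: "\<And>y. y \<in> W \<Longrightarrow> B *v y \<in> W"
  shows "\<exists>y \<nu>. y \<in> W \<and> y \<noteq> 0 \<and> B *v y = \<nu> *\<^sub>R y"
proof -
  have tA: "transpose A = A" and pos: "\<And>x. x \<noteq> 0 \<Longrightarrow> 0 < x \<bullet> (A *v x)"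
    using pd by (auto simp: positive_definite_def)
  have symA: "u \<bullet> (A *v w) = w \<bullet> (A *v u)" for u w
    by (metis tA dot_lmul_matrix inner_commute transpose_matrix_vector)
  define K where "K = W \<inter> sphere 0 1"
  define q where "q y = (y \<bullet> (A *v (B *v y))) / (y \<bullet> (A *v y))" for y
  have q_scale: "q (s *\<^sub>R y) = q y" if "s \<noteq> 0" for s y
    using that by (simp add: q_def matrix_vector_mult_scaleR)
  obtain w0 where w0: "w0 \<in> W" "w0 \<noteq> 0" using W subspace_0 by blast
  have "compact K" unfolding K_def using closed_subspace[OF W(1)] by (intro closed_Int_compact) auto
  moreover have "(1 / norm w0) *\<^sub>R w0 \<in> K" using w0 W(1) by (auto simp: K_def subspace_scale)
  then have "K \<noteq> {}" by blast
  moreover have "continuous_on K q"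
  proof -
    have "y \<bullet> (A *v y) \<noteq> 0" if "y \<in> K" for y
      using that pos[of y] by (cases "y = 0") (auto simp: K_def)
    then show ?thesis
      unfolding q_def matrix_vector_mul_assoc
      by (intro continuous_on_divide continuous_on_inner continuous_on_id ballI
          linear_continuous_on[OF matrix_vector_mul_bounded_linear])
  qed
  ultimately have "\<exists>y\<in>K. \<forall>z\<in>K. q z \<le> q y" by (rule continuous_attains_sup)
  then obtain y where y: "y \<in> K" "\<And>z. z \<in> K \<Longrightarrow> q z \<le> q y" by auto
  have yW: "y \<in> W" "y \<noteq> 0" using y(1) by (auto simp: K_def)
  define m where "m = q y"
  have qm: "q w \<le> m" if "w \<in> W" "w \<noteq> 0" for w
  proof -
    have "(1 / norm w) *\<^sub>R w \<in> K" using that W(1) by (auto simp: K_def subspace_scale)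
    from y(2)[OF this] show ?thesis using that by (simp add: q_scale m_def)
  qed
  define g where "g w = m * (w \<bullet> (A *v w)) - w \<bullet> (A *v (B *v w))" for w
  have g0: "0 \<le> g w" if "w \<in> W" for w
  proof (cases "w = 0")
    case False
    with qm[OF that False] pos[OF False] show ?thesis by (simp add: g_def q_def pos_divide_le_eq)
  qed (simp add: g_def)
  have gy: "g y = 0" using pos[OF yW(2)] by (simp add: g_def m_def q_def)
  \<comment> \<open>The form \<open>g\<close> is nonnegative on \<open>W\<close> and vanishes at
    \<open>y\<close>. Moving from \<open>y\<close> along \<open>- z\<close> changes \<open>g\<close>
    to first order by -2 times the squared \<open>A\<close>-norm of the residual \<open>z\<close>,
    which forces \<open>z = 0\<close>.\<close>
  define z where "z = m *\<^sub>R y - B *v y"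
  have zW: "z \<in> W" unfolding z_def using W(1) yW inv by (intro subspace_diff subspace_scale) auto
  have expand: "g (y - s *\<^sub>R z) = g y + s * s * g z - 2 * s * (z \<bullet> (A *v z))" for s
  proof -
    have c: "y \<bullet> (A *v (B *v z)) = z \<bullet> (A *v (B *v y))"
      using selfadjoint_inner[OF tA sa, of y z] symA by simp
    have "A *v z = m *\<^sub>R (A *v y) - A *v (B *v y)"
      by (simp add: z_def matrix_vector_mult_diff_distrib matrix_vector_mult_scaleR)
    then have zz: "z \<bullet> (A *v z) = m * (z \<bullet> (A *v y)) - z \<bullet> (A *v (B *v y))"
      by (simp add: inner_diff_right)
    show ?thesis
      by (simp add: g_def matrix_vector_mult_diff_distrib matrix_vector_mult_scaleR inner_diff_right
          inner_diff_left c symA[of y z] zz algebra_simps)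
  qed
  have "z \<bullet> (A *v z) = 0"
  proof (rule quadratic_form_zero)
    show "0 \<le> z \<bullet> (A *v z)" using pos[of z] by (cases "z = 0") auto
    fix s
    have "y - s *\<^sub>R z \<in> W" using W(1) yW zW by (intro subspace_diff subspace_scale) auto
    from g0[OF this] show "0 \<le> s * s * g z - 2 * s * (z \<bullet> (A *v z))" by (simp add: expand gy)
  qed
  then have "z = 0" using pos[of z] by fastforce
  then have "B *v y = m *\<^sub>R y" by (simp add: z_def)
  with yW show ?thesis by blast
qed

text \<open>A polynomial in \<open>B\<close>, kept as the list of its roots. It inherits
  commutation, self-adjointness and analyticity from \<open>B\<close>, and its value at a number
  outside the list is visibly nonzero.\<close>

primrec root_prod :: "real list \<Rightarrow> real^'m^'m \<Rightarrow> real^'m^'m" where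
  "root_prod [] B = mat 1"
| "root_prod (\<nu> # L) B = (B - \<nu> *\<^sub>R mat 1) ** root_prod L B"

lemma root_prod_commute:
  assumes "X ** B = B ** X" shows "X ** root_prod L B = root_prod L B ** X"
proof (induction L)
  case (Cons \<nu> L)
  have "X ** (B - \<nu> *\<^sub>R mat 1) = (B - \<nu> *\<^sub>R mat 1) ** X"
    using assms
      by (simp add: matrix_diff_ldistrib matrix_diff_rdistrib matrix_scaleR_left
        matrix_scaleR_right)
  then show ?case using Cons by simp (metis matrix_mul_assoc)
qed simp

lemma root_prod_selfadjoint:
  assumes "transpose A = A" "selfadjoint A B" shows "selfadjoint A (root_prod L B)"
proof (induction L)
  case (Cons \<nu> L)
  have "(B - \<nu> *\<^sub>R mat 1) ** B = B ** (B - \<nu> *\<^sub>R mat 1)"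
    by (simp add: matrix_diff_ldistrib matrix_diff_rdistrib matrix_scaleR_left matrix_scaleR_right)
  from root_prod_commute[OF this] Cons assms show ?case
    by (auto intro!: selfadjoint_mult selfadjoint_diff selfadjoint_scaleR selfadjoint_mat1)
qed (simp add: selfadjoint_mat1 assms)

lemma root_prod_eigenvector:
  assumes "B *v y = \<nu> *\<^sub>R y"
  shows "root_prod L B *v y = prod_list (map (\<lambda>\<mu>. \<nu> - \<mu>) L) *\<^sub>R y"
proof (induction L)
  case (Cons \<mu> L)
  have "(B - \<mu> *\<^sub>R mat 1) *v y = (\<nu> - \<mu>) *\<^sub>R y"
    using assms
      by (simp add: matrix_vector_mult_diff_rdistrib scaleR_matrix_vector_assoc[symmetric]
        algebra_simps)
  with Cons show ?case
    by (simp add: matrix_vector_mul_assoc[symmetric] matrix_vector_mult_scaleR)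
qed simp

lemma root_prod_mat_analytic_at: "mat_analytic_at B x \<Longrightarrow> mat_analytic_at (\<lambda>t. root_prod L (B t)) x"
  by (induction L) (auto intro!: mat_analytic_at_mult mat_analytic_at_diff mat_analytic_at_const)

text \<open>Moving one \<open>G\<close> across the \<open>A\<close>-inner product turns the pairing
  of \<open>w\<close> with the double image into the squared \<open>A\<close>-norm of
  \<open>G w\<close>. In other words, \<open>G\<close> has no nilpotent part.\<close>

lemma selfadjoint_square_kernel:
  assumes "positive_definite A" "selfadjoint A G" "G *v (G *v w) = 0"
  shows "G *v w = 0"
proof (rule ccontr)
  assume "G *v w \<noteq> 0"
  then have "0 < (G *v w) \<bullet> (A *v (G *v w))" using assms(1) by (simp add: positive_definite_def)
  also have "\<dots> = w \<bullet> (A *v (G *v (G *v w)))"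
    using assms selfadjoint_inner[of A G w "G *v w"] by (simp add: positive_definite_def)
  finally show False using assms(3) by simp
qed

lemma subspace_range_mult: "subspace (range ((*v) (G :: real^'m^'m)))"
  by (intro linear_subspace_image matrix_vector_mul_linear subspace_UNIV)

text \<open>If the ranges agreed, \<open>E\<close> would fix the range of \<open>P\<close>, so
  \<open>E ** P\<close> would be \<open>P\<close> instead of \<open>E\<close>. This gives the
  descent for the analytic eigenvector.\<close>

lemma dim_range_less:
  fixes E P :: "real^'m^'m"
  assumes "P ** E = E" "E ** E = E" "E ** P = E" "E \<noteq> P"
  shows "dim (range ((*v) E)) < dim (range ((*v) P))"
proof (rule dim_psubset)
  have "range ((*v) E) \<subseteq> range ((*v) P)"
    by (metis assms(1) matrix_vector_mul_assoc image_subsetI rangeI)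
  moreover have "range ((*v) E) \<noteq> range ((*v) P)"
  proof
    assume eq: "range ((*v) E) = range ((*v) P)"
    have "E *v (P *v z) = P *v z" for z
    proof -
      have "P *v z \<in> range ((*v) E)" using eq by blast
      then obtain u where "P *v z = E *v u" by blast
      then show ?thesis by (simp add: matrix_vector_mul_assoc assms(2))
    qed
    then have "E ** P = P" by (simp add: matrix_eq matrix_vector_mul_assoc)
    with assms(3,4) show False by simp
  qed
  ultimately show "span (range ((*v) E)) \<subset> span (range ((*v) P))"
    by (simp add: span_eq_iff[THEN iffD2, OF subspace_range_mult] psubset_eq)
qed

text \<open>The product of the \<open>B - \<nu> I\<close> is a multiple of the projection onto the \<open>\<mu>\<close>-eigenspace.
  It is found by maximizing the kernel of the product over all lists avoiding \<open>\<mu>\<close>.\<close>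

lemma spectral_root_prod:
  fixes A B :: "real^'m^'m"
  assumes pd: "positive_definite A" and sa: "selfadjoint A B" and "B \<noteq> 0"
  shows "\<exists>\<mu> L. \<mu> \<noteq> 0 \<and> \<mu> \<notin> set L \<and> root_prod L B \<noteq> 0 \<and> B ** root_prod L B = \<mu> *\<^sub>R root_prod L B"
proof -
  have tA: "transpose A = A" using pd by (simp add: positive_definite_def)
  have "\<exists>z. B *v z \<noteq> 0" using \<open>B \<noteq> 0\<close> by (metis matrix_eq matrix_vector_mult_0)
  then have "range ((*v) B) \<noteq> {0}" by auto
  then obtain y \<mu> where y: "y \<in> range ((*v) B)" "y \<noteq> 0" "B *v y = \<mu> *\<^sub>R y"
    using selfadjoint_eigenvector[OF pd sa subspace_range_mult] by blast
  \<comment> \<open>\<open>y\<close> lies in the range of \<open>B\<close>, say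
    \<open>y = B w\<close>; if \<open>\<mu>\<close> were 0, then \<open>B B w\<close> would vanish
    and hence \<open>y\<close> too.\<close>
  have "\<mu> \<noteq> 0"
    using y selfadjoint_square_kernel[OF pd sa] by auto
  define kd where "kd L = dim {z. root_prod L B *v z = 0}" for L
  have "kd L \<le> DIM(real^'m)" for L unfolding kd_def by (rule dim_subset_UNIV)
  then obtain L where L: "\<mu> \<notin> set L" "\<And>L'. \<mu> \<notin> set L' \<Longrightarrow> kd L' \<le> kd L"
    using ex_has_greatest_nat[of "\<lambda>L. \<mu> \<notin> set L" "[]" kd "DIM(real^'m) + 1"]
    by (auto simp: le_imp_less_Suc)
  define R where "R = root_prod L B"
  define G where "G = (B - \<mu> *\<^sub>R mat 1) ** R"
  have comm: "R ** B = B ** R" unfolding R_def using root_prod_commute[of B B L] by simp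
  have saR: "selfadjoint A R" unfolding R_def by (rule root_prod_selfadjoint[OF tA sa])
  have G_root: "G = root_prod (\<mu> # L) B" by (simp add: G_def R_def)
  have saG: "selfadjoint A G" unfolding G_root by (rule root_prod_selfadjoint[OF tA sa])
  have BG: "B ** G = G ** B" unfolding G_root by (rule root_prod_commute) simp
  have GR: "G = R ** (B - \<mu> *\<^sub>R mat 1)"
    unfolding G_def using comm
    by (simp add: matrix_diff_ldistrib matrix_diff_rdistrib matrix_scaleR_left matrix_scaleR_right)
  \<comment> \<open>Otherwise the range of \<open>G\<close> contains an eigenvector \<open>z\<close>
    of \<open>B\<close> for some \<open>\<nu>\<close>. The square-kernel lemma excludes both
    \<open>\<nu> = \<mu>\<close> and \<open>R z = 0\<close>, so adding \<open>\<nu>\<close> to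
    \<open>L\<close> would enlarge the kernel by \<open>z\<close>, against maximality.\<close>
  have "G = 0"
  proof (rule ccontr)
    assume "G \<noteq> 0"
    then have "\<exists>z. G *v z \<noteq> 0" by (metis matrix_eq matrix_vector_mult_0)
    then have "range ((*v) G) \<noteq> {0}" by auto
    moreover have "B *v z \<in> range ((*v) G)" if "z \<in> range ((*v) G)" for z
      using that BG by (auto simp: matrix_vector_mul_assoc) (metis matrix_vector_mul_assoc rangeI)
    ultimately obtain z \<nu> where z: "z \<in> range ((*v) G)" "z \<noteq> 0" "B *v z = \<nu> *\<^sub>R z"
      using selfadjoint_eigenvector[OF pd sa subspace_range_mult] by blast
    obtain w where w: "z = G *v w" using z(1) by blast
    have "\<nu> \<noteq> \<mu>"
    proof
      assume "\<nu> = \<mu>"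
      then have "(B - \<mu> *\<^sub>R mat 1) *v z = 0"
        using z(3)
          by (simp add: matrix_vector_mult_diff_rdistrib scaleR_matrix_vector_assoc[symmetric])
      then have "G *v (G *v w) = 0"
        unfolding w[symmetric] by (simp add: GR matrix_vector_mul_assoc[symmetric])
      from selfadjoint_square_kernel[OF pd saG this] show False using z(2) w by simp
    qed
    have Rz: "R *v z \<noteq> 0"
    proof
      assume 0: "R *v z = 0"
      define w' where "w' = (B - \<mu> *\<^sub>R mat 1) *v w"
      have zR: "z = R *v w'" by (simp add: w GR w'_def matrix_vector_mul_assoc)
      with 0 have "R *v (R *v w') = 0" by simp
      from selfadjoint_square_kernel[OF pd saR this] show False using z(2) zR by simp
    qed
    let ?k = "\<lambda>L. {z. root_prod L B *v z = 0}"
    have sub: "subspace (?k L)" for L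
      using linear_subspace_kernel[OF matrix_vector_mul_linear] by blast
    have "?k L \<subset> ?k (\<nu> # L)"
    proof
      show "?k L \<subseteq> ?k (\<nu> # L)" by (auto simp: matrix_vector_mul_assoc[symmetric])
      have "(B - \<nu> *\<^sub>R mat 1) ** R = R ** (B - \<nu> *\<^sub>R mat 1)"
        using comm
          by (simp add: matrix_diff_ldistrib matrix_diff_rdistrib matrix_scaleR_left
            matrix_scaleR_right)
      moreover have "(B - \<nu> *\<^sub>R mat 1) *v z = 0"
        using z(3)
          by (simp add: matrix_vector_mult_diff_rdistrib scaleR_matrix_vector_assoc[symmetric])
      ultimately have "root_prod (\<nu> # L) B *v z = 0"
        by (simp add: R_def[symmetric] matrix_vector_mul_assoc[symmetric])
      with Rz show "?k L \<noteq> ?k (\<nu> # L)" unfolding R_def by blast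
    qed
    then have "kd L < kd (\<nu> # L)"
      unfolding kd_def by (intro dim_psubset) (simp only: span_eq_iff[THEN iffD2, OF sub])
    moreover have "kd (\<nu> # L) \<le> kd L" using L \<open>\<nu> \<noteq> \<mu>\<close> by simp
    ultimately show False by simp
  qed
  then have "B ** R = \<mu> *\<^sub>R R"
    by (simp add: G_def matrix_diff_rdistrib matrix_scaleR_left)
  moreover have "R \<noteq> 0"
  proof
    assume "R = 0"
    then have "prod_list (map (\<lambda>\<nu>. \<mu> - \<nu>) L) *\<^sub>R y = 0"
      using root_prod_eigenvector[OF y(3), of L] by (simp add: R_def)
    then show False using y(2) L(1) by (auto simp: prod_list_zero_iff)
  qed
  ultimately show ?thesis using \<open>\<mu> \<noteq> 0\<close> L(1) unfolding R_def by blast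
qed

section \<open>Analytic eigenvectors\<close>

text \<open>With \<open>Z = P\<close> this says that \<open>P\<close> is an
  \<open>A\<close>-orthogonal projection commuting with \<open>T\<close>. In general
  \<open>Z\<close> ranges over the corner cut out by \<open>P\<close>, which is closed under linear
  combinations, commuting products and limits.\<close>

definition compatible :: "real^'m^'m \<Rightarrow> real^'m^'m \<Rightarrow> real^'m^'m \<Rightarrow> real^'m^'m \<Rightarrow> bool" where
  "compatible A T P Z \<longleftrightarrow> selfadjoint A Z \<and> T ** Z = Z ** T \<and> P ** Z = Z \<and> Z ** P = Z"

lemma compatible_diff: "compatible A T P X \<Longrightarrow> compatible A T P Y \<Longrightarrow> compatible A T P (X - Y)"
  by (simp add: compatible_def selfadjoint_diff matrix_diff_ldistrib matrix_diff_rdistrib)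

lemma compatible_add: "compatible A T P X \<Longrightarrow> compatible A T P Y \<Longrightarrow> compatible A T P (X + Y)"
  by (simp add: compatible_def selfadjoint_add matrix_add_ldistrib matrix_add_rdistrib)

lemma compatible_scaleR: "compatible A T P X \<Longrightarrow> compatible A T P (c *\<^sub>R X)"
  by (simp add: compatible_def selfadjoint_scaleR matrix_scaleR_left matrix_scaleR_right)

lemma compatible_mult:
  assumes "transpose A = A" "compatible A T P X" "compatible A T P Y" "X ** Y = Y ** X"
  shows "compatible A T P (X ** Y)"
  using assms selfadjoint_mult[of A X Y] unfolding compatible_def
  by (metis matrix_mul_assoc)

lemma compatible_purify_iter:
  assumes "transpose A = A" "compatible A T P X"
  shows "compatible A T P ((purify ^^ k) X)"
proof (induction k)
  case (Suc k)
  let ?Y = "(purify ^^ k) X"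
  have "compatible A T P (?Y ** ?Y)" by (rule compatible_mult[OF assms(1) Suc Suc refl])
  moreover have "compatible A T P (?Y ** ?Y ** ?Y)"
    by (rule compatible_mult[OF assms(1) calculation Suc]) (simp add: matrix_mul_assoc)
  ultimately show ?case
    unfolding funpow.simps o_def purify_def[of ?Y] by (intro compatible_diff compatible_add)
qed (use assms in simp)

lemma tendsto_transpose:
  fixes X :: "'b \<Rightarrow> real^'m^'m"
  assumes "(X \<longlongrightarrow> L) F" shows "((\<lambda>t. transpose (X t)) \<longlongrightarrow> transpose L) F"
  unfolding transpose_def by (intro vec_tendstoI) (auto intro!: tendsto_intros assms)

lemma compatible_limit:
  assumes "Z \<longlonglongrightarrow> Q" "\<And>k. compatible A T P (Z k)" shows "compatible A T P Q"
proof -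
  have l: "(\<lambda>k. X ** Z k) \<longlonglongrightarrow> X ** Q" "(\<lambda>k. Z k ** X) \<longlonglongrightarrow> Q ** X" for X
    by (intro tendsto_matrix_mult tendsto_const assms(1))+
  have "transpose (A ** Q) = A ** Q"
    by (rule LIMSEQ_unique[OF tendsto_transpose[OF l(1)]])
      (use assms(2) l(1)[of A] in \<open>simp add: compatible_def selfadjoint_def\<close>)
  moreover have "T ** Q = Q ** T"
    by (rule LIMSEQ_unique[OF l(1)]) (use assms(2) l(2)[of T] in \<open>simp add: compatible_def\<close>)
  moreover have "P ** Q = Q"
    by (rule LIMSEQ_unique[OF l(1)]) (use assms in \<open>simp add: compatible_def\<close>)
  moreover have "Q ** P = Q"
    by (rule LIMSEQ_unique[OF l(2)]) (use assms in \<open>simp add: compatible_def\<close>)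
  ultimately show ?thesis by (simp add: compatible_def selfadjoint_def)
qed

text \<open>Each condition is the vanishing of an analytic matrix, so it passes from a punctured
  neighbourhood to \<open>x\<close>.\<close>

lemma compatible_at:
  assumes "mat_analytic_at A x" "mat_analytic_at T x" "mat_analytic_at P x" "mat_analytic_at C x"
    "\<forall>\<^sub>F t in at x. compatible (A t) (T t) (P t) (C t)"
  shows "\<forall>\<^sub>F t in nhds x. compatible (A t) (T t) (P t) (C t)"
proof -
  note intros = mat_analytic_at_diff mat_analytic_at_mult mat_analytic_at_transpose assms(1-4)
  have "\<forall>\<^sub>F t in nhds x. transpose (A t ** C t) - A t ** C t = 0"
    by (intro mat_analytic_at_zero_at intros)
      (use assms(5) in \<open>auto simp: compatible_def selfadjoint_def elim: eventually_mono\<close>)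
  moreover have "\<forall>\<^sub>F t in nhds x. T t ** C t - C t ** T t = 0"
    by (intro mat_analytic_at_zero_at intros) (use assms(5) in \<open>auto simp: compatible_def elim:
      eventually_mono\<close>)
  moreover have "\<forall>\<^sub>F t in nhds x. P t ** C t - C t = 0"
    by (intro mat_analytic_at_zero_at intros) (use assms(5) in \<open>auto simp: compatible_def elim:
      eventually_mono\<close>)
  moreover have "\<forall>\<^sub>F t in nhds x. C t ** P t - C t = 0"
    by (intro mat_analytic_at_zero_at intros) (use assms(5) in \<open>auto simp: compatible_def elim:
      eventually_mono\<close>)
  ultimately show ?thesis by eventually_elim (simp add: compatible_def selfadjoint_def)
qed

text \<open>The rank of \<open>P x\<close> drops whenever the chosen Rayleigh quotient fails to make
  \<open>T\<close> scalar on the range of \<open>P\<close>. The projection stays nonzero at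
  \<open>x\<close>, so the descent ends with an eigenvector.\<close>

lemma selfadjoint_analytic_eigenvector:
  fixes A T P :: "real \<Rightarrow> real^'m^'m"
  assumes A: "mat_analytic_at A x" and T: "mat_analytic_at T x"
    and AT: "\<forall>\<^sub>F t in nhds x. positive_definite (A t) \<and> selfadjoint (A t) (T t)"
    and "mat_analytic_at P x" "P x \<noteq> 0"
    and "\<forall>\<^sub>F t in nhds x. compatible (A t) (T t) (P t) (P t)"
  shows "\<exists>y l. vec_analytic_at y x \<and> real_analytic_at l x \<and> y x \<noteq> 0 \<and>
    (\<forall>\<^sub>F t in nhds x. P t *v y t = y t \<and> T t *v y t = l t *\<^sub>R y t)"
  using assms(4-)
proof (induction "dim (range ((*v) (P x)))" arbitrary: P rule: less_induct)
  case less
  note P = less.prems(1) and P0 = less.prems(2) and PT = less.prems(3)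
  have pd: "positive_definite (A x)" using eventually_nhds_x_imp_x[OF AT] by simp
  obtain e where e: "P x *v e \<noteq> 0" using P0 by (metis matrix_eq matrix_vector_mult_0)
  define y0 where "y0 t = P t *v e" for t
  have y0: "vec_analytic_at y0 x"
    unfolding y0_def by (intro vec_analytic_at_mult vec_analytic_at_const P)
  define q where "q t = y0 t \<bullet> (A t *v y0 t)" for t
  define l where "l t = (y0 t \<bullet> (A t *v (T t *v y0 t))) / q t" for t
  have q: "real_analytic_at q x"
    unfolding q_def by (intro real_analytic_at_inner vec_analytic_at_mult A y0)
  have qx: "q x > 0" using e pd by (simp add: positive_definite_def q_def y0_def)
  have l: "real_analytic_at l x" unfolding l_def using qx
    by (intro real_analytic_at_divide q real_analytic_at_inner vec_analytic_at_mult A T y0) auto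
  \<comment> \<open>Subtracting the Rayleigh quotient makes the \<open>A\<close>-form of
    \<open>B t\<close> vanish at \<open>y0 t\<close>; this is what later distinguishes
    \<open>Q x\<close> from \<open>P x\<close>.\<close>
  define B where "B t = T t ** P t - l t *\<^sub>R P t" for t
  have B: "mat_analytic_at B x"
    unfolding B_def by (intro mat_analytic_at_diff mat_analytic_at_scaleR mat_analytic_at_mult P
      T l)
  show ?case
  proof (cases "\<forall>\<^sub>F t in nhds x. B t = 0")
    case True
    with PT have "\<forall>\<^sub>F t in nhds x. P t *v y0 t = y0 t \<and> T t *v y0 t = l t *\<^sub>R y0 t"
    proof eventually_elim
      case (elim t)
      then have "T t ** P t = l t *\<^sub>R P t" by (simp add: B_def)
      with elim(1) show ?case
        by (simp add: compatible_def y0_def matrix_vector_mul_assoc scaleR_matrix_vector_assoc)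
    qed
    moreover have "y0 x \<noteq> 0" using e by (simp add: y0_def)
    ultimately show ?thesis using y0 l by blast
  next
    case False
    from mat_analytic_at_factor[OF B False] obtain k C where C: "mat_analytic_at C x" "C x \<noteq> 0"
      and BC: "\<forall>\<^sub>F t in nhds x. B t = (t - x) ^ k *\<^sub>R C t" by blast
    have qpos: "\<forall>\<^sub>F t in nhds x. q t > 0"
      using real_analytic_at_isCont[OF q] qx by (rule isCont_eventually_pos)
    have Bprop: "\<forall>\<^sub>F t in nhds x. compatible (A t) (T t) (P t) (B t) \<and> y0 t \<bullet> (A t *v (B t *v y0 t)) = 0"
      using AT PT qpos
    proof eventually_elim
      case (elim t)
      have tA: "transpose (A t) = A t" using elim by (simp add: positive_definite_def)
      have "compatible (A t) (T t) (P t) (T t ** P t)"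
        using elim selfadjoint_mult[OF tA, of "T t" "P t"] unfolding compatible_def
        by (metis matrix_mul_assoc)
      then have "compatible (A t) (T t) (P t) (B t)"
        unfolding B_def using elim by (intro compatible_diff compatible_scaleR) auto
      moreover have "P t *v y0 t = y0 t"
        using elim by (simp add: y0_def compatible_def matrix_vector_mul_assoc)
      then have "B t *v y0 t = T t *v y0 t - l t *\<^sub>R y0 t"
        by (simp add: B_def matrix_vector_mult_diff_rdistrib matrix_vector_mul_assoc[symmetric]
            scaleR_matrix_vector_assoc[symmetric])
      then have "y0 t \<bullet> (A t *v (B t *v y0 t)) = y0 t \<bullet> (A t *v (T t *v y0 t)) - l t * q t"
        by (simp add: matrix_vector_mult_diff_distrib inner_diff_right matrix_vector_mult_scaleR
          q_def)
      moreover have "\<dots> = 0" using elim by (simp add: l_def)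
      ultimately show ?case by simp
    qed
    have "\<forall>\<^sub>F t in at x. compatible (A t) (T t) (P t) (C t) \<and> y0 t \<bullet> (A t *v (C t *v y0 t)) = 0"
      using eventually_nhds_imp_at[OF Bprop] eventually_nhds_imp_at[OF BC]
        eventually_neq_at_within[of x x UNIV]
    proof eventually_elim
      case (elim t)
      \<comment> \<open>Off \<open>x\<close> the matrix \<open>C t\<close> is a multiple of
        \<open>B t\<close> and inherits its homogeneous relations; continuity then yields them at
        \<open>x\<close>.\<close>
      then have C_eq: "C t = inverse ((t - x) ^ k) *\<^sub>R B t" by simp
      show ?case unfolding C_eq using elim(1)
        by (auto simp: scaleR_matrix_vector_assoc[symmetric] matrix_vector_mult_scaleR intro:
          compatible_scaleR)
    qed
    then have at1: "\<forall>\<^sub>F t in at x. compatible (A t) (T t) (P t) (C t)"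
      and at2: "\<forall>\<^sub>F t in at x. y0 t \<bullet> (A t *v (C t *v y0 t)) = 0"
      by (auto elim: eventually_mono)
    have compC: "\<forall>\<^sub>F t in nhds x. compatible (A t) (T t) (P t) (C t)"
      by (rule compatible_at[OF A T P C(1) at1])
    have "\<forall>\<^sub>F t in nhds x. y0 t \<bullet> (A t *v (C t *v y0 t)) = 0"
      by (intro real_analytic_at_zero_at at2 real_analytic_at_inner vec_analytic_at_mult A C y0)
    then have y0C: "y0 x \<bullet> (A x *v (C x *v y0 x)) = 0" by (rule eventually_nhds_x_imp_x)
    have compCx: "compatible (A x) (T x) (P x) (C x)" using compC by (rule eventually_nhds_x_imp_x)
    have compPx: "compatible (A x) (T x) (P x) (P x)" using PT by (rule eventually_nhds_x_imp_x)
    obtain \<mu> L where \<mu>: "\<mu> \<noteq> 0" "\<mu> \<notin> set L" "root_prod L (C x) \<noteq> 0"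
      "C x ** root_prod L (C x) = \<mu> *\<^sub>R root_prod L (C x)"
      using spectral_root_prod[OF pd _ C(2)] compCx unfolding compatible_def by blast
    define c where "c = prod_list (map (\<lambda>\<nu>. \<mu> - \<nu>) L)"
    have c: "c \<noteq> 0" using \<mu>(2) by (auto simp: c_def prod_list_zero_iff)
    define R where "R t = root_prod L (C t)" for t
    \<comment> \<open>\<open>c\<close> is the value at \<open>\<mu>\<close> of the polynomial with
      roots \<open>L\<close>, so dividing by it makes \<open>R x\<close> idempotent. The factor
      \<open>P t\<close> keeps \<open>X t\<close> in the corner of \<open>P t\<close>, since a
      polynomial in \<open>C t\<close> may act nontrivially on the kernel of \<open>P t\<close>. At
      \<open>x\<close> this factor changes nothing.\<close>
    define X where "X t = inverse c *\<^sub>R (R t ** P t)" for t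
    have X: "mat_analytic_at X x" unfolding X_def R_def
      by (intro mat_analytic_at_scaleR mat_analytic_at_mult root_prod_mat_analytic_at
        real_analytic_at_const C P)
    have "R x ** C x = C x ** R x" unfolding R_def using root_prod_commute[of "C x" "C x" L] by simp
    then have RC: "R x ** C x = \<mu> *\<^sub>R R x" using \<mu>(4) by (simp add: R_def)
    have "\<mu> *\<^sub>R (R x ** P x) = R x ** (C x ** P x)"
      using RC by (simp add: matrix_mul_assoc matrix_scaleR_left)
    also have "\<dots> = \<mu> *\<^sub>R R x" using compCx RC by (simp add: compatible_def)
    finally have RP: "R x ** P x = R x" using \<mu>(1) by simp
    have Xx: "X x = inverse c *\<^sub>R R x" by (simp add: X_def RP)
    have RR: "R x ** R x = c *\<^sub>R R x"
    proof -
      have "R x *v (R x *v z) = c *\<^sub>R (R x *v z)" for z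
        unfolding R_def c_def
        by (rule root_prod_eigenvector)
          (simp add: matrix_vector_mul_assoc \<mu>(4) scaleR_matrix_vector_assoc)
      then show ?thesis
        by (simp add: matrix_eq matrix_vector_mul_assoc[symmetric]
          scaleR_matrix_vector_assoc[symmetric])
    qed
    have idem: "X x ** X x = X x"
      using c by (simp add: Xx RR matrix_scaleR_left matrix_scaleR_right)
    have compX: "\<forall>\<^sub>F t in nhds x. compatible (A t) (T t) (P t) (X t)"
      using AT PT compC
    proof eventually_elim
      case (elim t)
      have tA: "transpose (A t) = A t" using elim by (simp add: positive_definite_def)
      have TR: "T t ** R t = R t ** T t" and PR: "P t ** R t = R t ** P t"
        unfolding R_def using elim by (auto intro!: root_prod_commute simp: compatible_def)
      have "selfadjoint (A t) (R t)" unfolding R_def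
        using elim by (intro root_prod_selfadjoint tA) (simp add: compatible_def)
      then have "selfadjoint (A t) (R t ** P t)"
        using elim PR by (intro selfadjoint_mult tA) (auto simp: compatible_def)
      then have "compatible (A t) (T t) (P t) (R t ** P t)"
        using elim TR PR unfolding compatible_def by (metis matrix_mul_assoc)
      then show ?case unfolding X_def by (rule compatible_scaleR)
    qed
    obtain Q where Q: "mat_analytic_at Q x" "Q x = X x"
      and Qlim: "\<forall>\<^sub>F t in nhds x. Q t ** Q t = Q t \<and> (\<lambda>k. (purify ^^ k) (X t)) \<longlonglongrightarrow> Q t"
      using mat_analytic_at_purify_limit[OF X idem] by blast
    have compQ: "\<forall>\<^sub>F t in nhds x. Q t ** Q t = Q t \<and> compatible (A t) (T t) (P t) (Q t)"
      using Qlim compX AT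
    proof eventually_elim
      case (elim t)
      then have "compatible (A t) (T t) (P t) ((purify ^^ k) (X t))" for k
        by (intro compatible_purify_iter) (auto simp: positive_definite_def)
      with elim show ?case using compatible_limit by blast
    qed
    have Qx0: "Q x \<noteq> 0" using \<mu>(3) c by (simp add: Q Xx R_def)
    have Qx: "Q x ** Q x = Q x" "P x ** Q x = Q x" "Q x ** P x = Q x"
      using eventually_nhds_x_imp_x[OF compQ] by (auto simp: compatible_def)
    \<comment> \<open>Equality would make \<open>y0 x\<close> an eigenvector of \<open>C x\<close>
      for the nonzero \<open>\<mu>\<close>, while its Rayleigh quotient for \<open>C x\<close> is
      0.\<close>
    have "Q x \<noteq> P x"
    proof
      assume QP: "Q x = P x"
      have "C x = C x ** P x" using compCx by (simp add: compatible_def)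
      also have "\<dots> = \<mu> *\<^sub>R P x"
        unfolding QP[symmetric] Q(2) Xx using \<mu>(4) by (simp add: R_def matrix_scaleR_right)
      finally have "C x *v y0 x = \<mu> *\<^sub>R y0 x"
        using compPx by (simp add: y0_def scaleR_matrix_vector_assoc matrix_vector_mul_assoc
            compatible_def matrix_scaleR_left)
      then have "\<mu> * q x = 0" using y0C by (simp add: matrix_vector_mult_scaleR q_def)
      with \<mu>(1) qx show False by simp
    qed
    from dim_range_less[OF Qx(2,1,3) this]
    have dim: "dim (range ((*v) (Q x))) < dim (range ((*v) (P x)))" .
    have "\<forall>\<^sub>F t in nhds x. compatible (A t) (T t) (Q t) (Q t)"
      using compQ by eventually_elim (simp add: compatible_def)
    from less.hyps[OF dim Q(1) Qx0 this] obtain y m where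
      y: "vec_analytic_at y x" "real_analytic_at m x" "y x \<noteq> 0"
        "\<forall>\<^sub>F t in nhds x. Q t *v y t = y t \<and> T t *v y t = m t *\<^sub>R y t" by blast
    from y(4) compQ have "\<forall>\<^sub>F t in nhds x. P t *v y t = y t \<and> T t *v y t = m t *\<^sub>R y t"
      by eventually_elim (metis compatible_def matrix_vector_mul_assoc)
    with y show ?thesis by blast
  qed
qed

section \<open>Local symplectic eigenbases\<close>

lemma sum_UNIV_Plus:
  "(\<Sum>j\<in>UNIV. f (j :: 'n::finite + 'm::finite)) = (\<Sum>k\<in>UNIV. f (Inl k)) + (\<Sum>k\<in>UNIV. f (Inr k))"
  unfolding UNIV_Plus_UNIV[symmetric] by (subst sum.Plus) auto

lemma J_nth [simp]:
  "(J *v x) $ Inl k = x $ Inr k" "(J *v x) $ Inr k = - x $ Inl k"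
  by (simp_all add: matrix_vector_mult_def sum_UNIV_Plus J_def block_matrix_def mat_def
      if_distrib[where f = "\<lambda>c. c * _"] sum_negf if_distrib[where f = uminus] cong: if_cong)

lemma J_J [simp]: "J *v (J *v x) = - x"
proof -
  have "(J *v (J *v x)) $ i = (- x) $ i" for i by (cases i) auto
  then show ?thesis by (simp add: vec_eq_iff)
qed

lemma inner_J: "x \<bullet> (J *v y) = - ((J *v x) \<bullet> y)"
  by (simp add: inner_vec_def sum_UNIV_Plus sum_negf)

lemma inner_J_swap: "x \<bullet> (J *v y) = - (y \<bullet> (J *v x))"
  by (simp add: inner_J[of x] inner_commute)

lemma inner_J_self [simp]: "x \<bullet> (J *v x) = 0"
  using inner_J_swap[of x x] by simp

lemma positive_definite_sym:
  assumes "positive_definite A" shows "x \<bullet> (A *v y) = (A *v x) \<bullet> y"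
  using assms unfolding positive_definite_def
  by (metis dot_lmul_matrix transpose_matrix_vector)

lemma positive_definite_pos: "positive_definite A \<Longrightarrow> x \<noteq> 0 \<Longrightarrow> 0 < x \<bullet> (A *v x)"
  by (simp add: positive_definite_def)

text \<open>Squares of symplectic eigenvalues are ordinary eigenvalues of this matrix: if
  \<open>A u = d J v\<close> and \<open>A v = - d J u\<close>, then \<open>J A\<close> sends
  \<open>u\<close> to \<open>- d v\<close> and \<open>v\<close> to \<open>d u\<close>.\<close>

definition neg_square :: "real^('n::finite + 'n)^('n + 'n) \<Rightarrow> real^('n + 'n)^('n + 'n)" where
  "neg_square A = - 1 *\<^sub>R ((J ** A) ** (J ** A))"

lemma neg_square_mult: "neg_square A *v x = - (J *v (A *v (J *v (A *v x))))"
  unfolding neg_square_def scaleR_matrix_vector_assoc[symmetric] matrix_vector_mul_assoc[symmetric]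
  by simp

text \<open>Moving the outer \<open>J\<close> across costs a sign and leaves the
  \<open>A\<close>-inner product of \<open>J A x\<close> and \<open>J A y\<close>. Self-adjointness
  and positivity of the eigenvalues both come from this formula.\<close>

lemma neg_square_inner:
  assumes "positive_definite A"
  shows "x \<bullet> (A *v (neg_square A *v y)) = (J *v (A *v x)) \<bullet> (A *v (J *v (A *v y)))"
proof -
  have "x \<bullet> (A *v (neg_square A *v y)) = - ((A *v x) \<bullet> (J *v (A *v (J *v (A *v y)))))"
    using positive_definite_sym[OF assms, of x] by (simp add: neg_square_mult)
  then show ?thesis by (simp add: inner_J)
qed

lemma selfadjoint_neg_square:
  assumes "positive_definite A" shows "selfadjoint A (neg_square A)"
proof (rule selfadjointI)
  fix x y
  show "x \<bullet> (A *v (neg_square A *v y)) = (A *v (neg_square A *v x)) \<bullet> y"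
    using neg_square_inner[OF assms, of x y] neg_square_inner[OF assms, of y x]
      positive_definite_sym[OF assms, of "J *v (A *v x)" "J *v (A *v y)"]
    by (simp add: inner_commute)
qed

section \<open>Partial eigenbases and deflation\<close>

definition partial_eigenbasis ::
  "'n::finite set \<Rightarrow> real^('n + 'n)^('n + 'n) \<Rightarrow> ('n \<Rightarrow> real) \<Rightarrow>
     ('n \<Rightarrow> real^('n + 'n)) \<Rightarrow> ('n \<Rightarrow> real^('n + 'n)) \<Rightarrow> bool" where
  "partial_eigenbasis F A d u v \<longleftrightarrow> (\<forall>i\<in>F. 0 < d i \<and>
     A *v u i = d i *\<^sub>R (J *v v i) \<and> A *v v i = - d i *\<^sub>R (J *v u i) \<and>
     (\<forall>j\<in>F. u i \<bullet> (J *v v j) = (if i = j then 1 else 0) \<and>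
       u i \<bullet> (J *v u j) = 0 \<and> v i \<bullet> (J *v v j) = 0))"

definition outer :: "real^'m \<Rightarrow> real^'m \<Rightarrow> real^'m^'m" where
  "outer a b = (\<chi> r c. a $ r * b $ c)"

lemma outer_mult: "outer a b *v y = (b \<bullet> y) *\<^sub>R a"
  by (simp add: outer_def matrix_vector_mult_def vec_eq_iff inner_vec_def sum_distrib_left
      sum_distrib_right mult_ac)

lemma mat_analytic_at_outer:
  "vec_analytic_at a x \<Longrightarrow> vec_analytic_at b x \<Longrightarrow> mat_analytic_at (\<lambda>t. outer (a t) (b t)) x"
  by (auto simp: mat_analytic_at_def vec_analytic_at_def outer_def)

text \<open>For a partial eigenbasis this is the \<open>A\<close>-orthogonal projection that removes
  the chosen pairs; \<open>u i\<close> and \<open>v i\<close> have squared \<open>A\<close>-norm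
  \<open>d i\<close>, whence the weights.\<close>

definition deflate ::
  "'n::finite set \<Rightarrow> real^('n + 'n)^('n + 'n) \<Rightarrow> ('n \<Rightarrow> real) \<Rightarrow>
     ('n \<Rightarrow> real^('n + 'n)) \<Rightarrow> ('n \<Rightarrow> real^('n + 'n)) \<Rightarrow> real^('n + 'n)^('n + 'n)" where
  "deflate F A d u v = mat 1 -
     (\<Sum>i\<in>F. (1 / d i) *\<^sub>R (outer (u i) (A *v u i) + outer (v i) (A *v v i)))"

lemma matrix_sum_vector_mult: "(\<Sum>i\<in>F. X i) *v y = (\<Sum>i\<in>F. X i *v (y :: real^'m))"
  by (induction F rule: infinite_finite_induct) (auto simp: matrix_vector_mult_add_rdistrib)

lemma matrix_vector_mult_sum: "X *v (\<Sum>i\<in>F. y i) = (\<Sum>i\<in>F. X *v (y i :: real^'m))"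
  by (rule linear_sum[OF matrix_vector_mul_linear])

lemma deflate_mult:
  "deflate F A d u v *v y =
     y - (\<Sum>i\<in>F. (1 / d i) *\<^sub>R (((A *v u i) \<bullet> y) *\<^sub>R u i + ((A *v v i) \<bullet> y) *\<^sub>R v i))"
  by (simp add: deflate_def matrix_vector_mult_diff_rdistrib matrix_sum_vector_mult
      scaleR_matrix_vector_assoc[symmetric] matrix_vector_mult_add_rdistrib outer_mult)

lemma mat_analytic_at_deflate:
  assumes "mat_analytic_at A x" "\<And>i. i \<in> F \<Longrightarrow> real_analytic_at (\<lambda>t. d t i) x \<and> d x i \<noteq> 0"
    "\<And>i. i \<in> F \<Longrightarrow> vec_analytic_at (\<lambda>t. u t i) x" "\<And>i. i \<in> F \<Longrightarrow> vec_analytic_at (\<lambda>t. v t i) x"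
  shows "mat_analytic_at (\<lambda>t. deflate F (A t) (d t) (u t) (v t)) x"
  unfolding deflate_def
  by (intro mat_analytic_at_diff mat_analytic_at_const mat_analytic_at_sum
    mat_analytic_at_scaleR mat_analytic_at_add mat_analytic_at_outer vec_analytic_at_mult
    real_analytic_at_divide real_analytic_at_const)
    (use assms in auto)

context
  fixes F :: "'n::finite set" and A d u v
  assumes pd: "positive_definite A" and pe: "partial_eigenbasis F A d u v"
begin

lemma pe_simps:
  assumes "i \<in> F"
  shows "0 < d i" "A *v u i = d i *\<^sub>R (J *v v i)" "A *v v i = - d i *\<^sub>R (J *v u i)"
  using pe assms by (auto simp: partial_eigenbasis_def)

text \<open>The eigenbasis equations turn \<open>A\<close>-products into multiples of symplectic
  products, so the symplectic relations become \<open>A\<close>-orthogonality.\<close>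

lemma pe_inner:
  assumes "i \<in> F" "j \<in> F"
  shows "(A *v u i) \<bullet> u j = (if i = j then d i else 0)" "(A *v v i) \<bullet> u j = 0"
    "(A *v u i) \<bullet> v j = 0" "(A *v v i) \<bullet> v j = (if i = j then d i else 0)"
proof -
  have "u j \<bullet> (J *v v i) = (if j = i then 1 else 0)" "u i \<bullet> (J *v v j) = (if i = j then 1 else 0)"
    "u i \<bullet> (J *v u j) = 0" "u j \<bullet> (J *v u i) = 0" "v j \<bullet> (J *v v i) = 0"
    using pe assms unfolding partial_eigenbasis_def by blast+
  then show "(A *v u i) \<bullet> u j = (if i = j then d i else 0)" "(A *v v i) \<bullet> u j = 0"
    "(A *v u i) \<bullet> v j = 0" "(A *v v i) \<bullet> v j = (if i = j then d i else 0)"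
    using pe_simps[OF assms(1)] inner_J_swap[of "v j" "u i"] by (auto simp: inner_commute)
qed

lemma neg_square_eigen:
  assumes "i \<in> F"
  shows "neg_square A *v u i = (d i * d i) *\<^sub>R u i" "neg_square A *v v i = (d i * d i) *\<^sub>R v i"
  by (simp_all add: neg_square_mult pe_simps[OF assms] matrix_vector_mult_scaleR
      linear_neg[OF matrix_vector_mul_linear])

lemma deflate_basis: "j \<in> F \<Longrightarrow> deflate F A d u v *v u j = 0" "j \<in> F \<Longrightarrow> deflate F A d u v *v v j = 0"
proof -
  assume j: "j \<in> F"
  have "(\<Sum>i\<in>F. (1 / d i) *\<^sub>R (((A *v u i) \<bullet> u j) *\<^sub>R u i + ((A *v v i) \<bullet> u j) *\<^sub>R v i)) =
      (\<Sum>i\<in>F. if i = j then u i else 0)"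
    using j pe_simps(1)[OF j] by (intro sum.cong) (auto simp: pe_inner)
  then show "deflate F A d u v *v u j = 0" using j by (simp add: deflate_mult)
  have "(\<Sum>i\<in>F. (1 / d i) *\<^sub>R (((A *v u i) \<bullet> v j) *\<^sub>R u i + ((A *v v i) \<bullet> v j) *\<^sub>R v i)) =
      (\<Sum>i\<in>F. if i = j then v i else 0)"
    using j pe_simps(1)[OF j] by (intro sum.cong) (auto simp: pe_inner)
  then show "deflate F A d u v *v v j = 0" using j by (simp add: deflate_mult)
qed

text \<open>The projection kills the vectors that it subtracts, hence is idempotent. These vectors
  are eigenvectors of the \<open>A\<close>-self-adjoint \<open>neg_square A\<close>, hence the two
  commute.\<close>

lemma deflate_compatible:
  "compatible A (neg_square A) (deflate F A d u v) (deflate F A d u v)"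
proof -
  let ?P = "deflate F A d u v" and ?T = "neg_square A"
  have lin: "X *v (y - (\<Sum>i\<in>F. (1 / d i) *\<^sub>R (a i *\<^sub>R u i + b i *\<^sub>R v i))) =
      X *v y - (\<Sum>i\<in>F. (1 / d i) *\<^sub>R (a i *\<^sub>R (X *v u i) + b i *\<^sub>R (X *v v i)))"
    for X :: "real^('n+'n)^('n+'n)" and y a b
    by (simp add: matrix_vector_mult_diff_distrib matrix_vector_mult_sum matrix_vector_mult_scaleR
        matrix_vector_right_distrib)
  have "?P *v (?P *v y) = ?P *v y" for y
    by (subst (2) deflate_mult, subst lin) (simp add: deflate_basis)
  then have PP: "?P ** ?P = ?P" by (simp add: matrix_eq matrix_vector_mul_assoc[symmetric])
  have "?T *v (?P *v y) = ?P *v (?T *v y)" for y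
  proof -
    have *: "(A *v w) \<bullet> (?T *v y) = (d i * d i) * ((A *v w) \<bullet> y)"
      if "?T *v w = (d i * d i) *\<^sub>R w" for w i
    proof -
      have "(A *v w) \<bullet> (?T *v y) = w \<bullet> (A *v (?T *v y))"
        using positive_definite_sym[OF pd] by simp
      also have "\<dots> = (?T *v w) \<bullet> (A *v y)"
        using selfadjoint_inner[OF _ selfadjoint_neg_square[OF pd]] pd
        by (simp add: positive_definite_def)
      finally show ?thesis using that positive_definite_sym[OF pd, of w y] by simp
    qed
    show ?thesis
      unfolding deflate_mult lin
      by (auto intro!: sum.cong simp: *[OF neg_square_eigen(1)] *[OF neg_square_eigen(2)]
          neg_square_eigen algebra_simps)
  qed
  then have TP: "?T ** ?P = ?P ** ?T" by (simp add: matrix_eq matrix_vector_mul_assoc[symmetric])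
  have "selfadjoint A ?P"
  proof (rule selfadjointI)
    fix x y
    show "x \<bullet> (A *v (?P *v y)) = (A *v (?P *v x)) \<bullet> y"
      unfolding deflate_mult lin
      using positive_definite_sym[OF pd, of x y]
      by (simp add: inner_diff_left inner_diff_right inner_sum_left inner_sum_right
          inner_add_left inner_add_right inner_commute mult_ac)
  qed
  with PP TP show ?thesis by (simp add: compatible_def)
qed

text \<open>Otherwise the at most \<open>2 * card F\<close> chosen vectors would span the whole
  space, of dimension \<open>2 * CARD('n)\<close>.\<close>

lemma deflate_nonzero:
  assumes "card F < CARD('n)" shows "deflate F A d u v \<noteq> 0"
proof
  assume 0: "deflate F A d u v = 0"
  let ?S = "u ` F \<union> v ` F"
  have "y \<in> span ?S" for y
  proof -
    have "y = (\<Sum>i\<in>F. (1 / d i) *\<^sub>R (((A *v u i) \<bullet> y) *\<^sub>R u i + ((A *v v i) \<bullet> y) *\<^sub>R v i))"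
      using deflate_mult[of F A d u v y] 0 by simp
    also have "\<dots> \<in> span ?S"
      by (intro span_sum span_scale span_add) (auto intro: span_base)
    finally show ?thesis .
  qed
  then have "UNIV \<subseteq> span ?S" by blast
  then have "dim (UNIV :: (real^('n+'n)) set) \<le> card ?S"
    by (intro dim_le_card) auto
  also have "\<dots> \<le> card (u ` F) + card (v ` F)" by (rule card_Un_le)
  also have "\<dots> \<le> card F + card F" by (intro add_mono card_image_le) auto
  finally show False using assms by simp
qed

lemma deflate_fixed:
  assumes "deflate F A d u v *v y = y" "i \<in> F"
  shows "(A *v u i) \<bullet> y = 0" "(A *v v i) \<bullet> y = 0"
proof -
  have *: "(A *v w) \<bullet> y = 0" if "deflate F A d u v *v w = 0" for w
  proof -
    have "(A *v w) \<bullet> y = w \<bullet> (A *v (deflate F A d u v *v y))"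
      using positive_definite_sym[OF pd, of w y] assms(1) by simp
    also have "\<dots> = (deflate F A d u v *v w) \<bullet> (A *v y)"
      using deflate_compatible pd
        by (intro selfadjoint_inner) (auto simp: compatible_def positive_definite_def)
    finally show ?thesis using that by simp
  qed
  show "(A *v u i) \<bullet> y = 0" "(A *v v i) \<bullet> y = 0"
    using deflate_basis assms(2) by (auto intro: *)
qed

text \<open>The scaling gives \<open>u'\<close> squared \<open>A\<close>-norm \<open>sqrt l\<close>,
  and \<open>v'\<close> is forced by \<open>A u' = sqrt l J v'\<close>. The other equation of the
  pair is then the eigenvalue equation of \<open>neg_square A\<close>. Positivity of
  \<open>l\<close> comes from the \<open>A\<close>-norm of \<open>J A y\<close>.\<close>

lemma partial_eigenbasis_insert:
  assumes k: "k \<notin> F" and y: "deflate F A d u v *v y = y" "neg_square A *v y = l *\<^sub>R y" "y \<noteq> 0"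
  defines "u' \<equiv> sqrt (sqrt l / (y \<bullet> (A *v y))) *\<^sub>R y"
  defines "v' \<equiv> (- 1 / sqrt l) *\<^sub>R (J *v (A *v u'))"
  shows "0 < l" "partial_eigenbasis (insert k F) A (d(k := sqrt l)) (u(k := u')) (v(k := v'))"
proof -
  define s where "s = y \<bullet> (A *v y)"
  have s: "s > 0" unfolding s_def by (rule positive_definite_pos[OF pd y(3)])
  have "J *v (A *v y) \<noteq> 0"
  proof
    assume "J *v (A *v y) = 0"
    then have "J *v (J *v (A *v y)) = 0" by simp
    then have "A *v y = 0" by simp
    with s show False by (simp add: s_def)
  qed
  then have "0 < y \<bullet> (A *v (neg_square A *v y))"
    unfolding neg_square_inner[OF pd] by (rule positive_definite_pos[OF pd])
  then have "0 < l * s" by (simp add: y(2) matrix_vector_mult_scaleR s_def)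
  with s show l: "0 < l" by (simp add: zero_less_mult_iff)
  define e where "e = sqrt l"
  have e: "e > 0" "e * e = l" using l by (auto simp: e_def)
  have v': "v' = (- 1 / e) *\<^sub>R (J *v (A *v u'))" by (simp add: v'_def e_def)
  have u'u': "u' \<bullet> (A *v u') = e"
  proof -
    define r where "r = sqrt (e / s)"
    have "u' = r *\<^sub>R y" by (simp add: u'_def r_def e_def s_def)
    then have "u' \<bullet> (A *v u') = r * r * s"
      by (simp add: s_def matrix_vector_mult_scaleR)
    moreover have "r * r = e / s" using e s by (simp add: r_def)
    ultimately show ?thesis using s by simp
  qed
  have Jv': "J *v v' = (1 / e) *\<^sub>R (A *v u')"
    by (simp add: v' matrix_vector_mult_scaleR linear_neg[OF matrix_vector_mul_linear])
  then have Au': "A *v u' = e *\<^sub>R (J *v v')" using e by simp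
  have "neg_square A *v u' = l *\<^sub>R u'" using y(2) by (simp add: u'_def matrix_vector_mult_scaleR)
  moreover have "J *v (A *v v') = (1 / e) *\<^sub>R (neg_square A *v u')"
    by (simp add: v' matrix_vector_mult_scaleR neg_square_mult linear_neg[OF
      matrix_vector_mul_linear])
  moreover have "l / e = e" using e by (simp add: field_simps)
  ultimately have "J *v (A *v v') = e *\<^sub>R u'" by simp
  then have "J *v (J *v (A *v v')) = e *\<^sub>R (J *v u')" by (simp add: matrix_vector_mult_scaleR)
  then have "- (A *v v') = e *\<^sub>R (J *v u')" by simp
  then have Av': "A *v v' = - e *\<^sub>R (J *v u')" by (metis minus_minus scaleR_minus_left)
  have self: "u' \<bullet> (J *v v') = 1" using u'u' e by (simp add: Jv')
  \<comment> \<open>\<open>J v'\<close> is a multiple of \<open>A u'\<close>, and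
    \<open>J v i\<close> and \<open>J u i\<close> are multiples of \<open>A u i\<close> and
    \<open>A v i\<close>. The mixed products thus become \<open>A\<close>-products of
    \<open>y\<close> with old vectors, which vanish; the remaining ones follow by
    antisymmetry.\<close>
  have cross: "u i \<bullet> (J *v v') = 0" "u' \<bullet> (J *v v i) = 0" "u i \<bullet> (J *v u') = 0"
    "u' \<bullet> (J *v u i) = 0"
    "v i \<bullet> (J *v v') = 0" "v' \<bullet> (J *v v i) = 0" if "i \<in> F" for i
  proof -
    have 0: "(A *v u i) \<bullet> u' = 0" "(A *v v i) \<bullet> u' = 0"
      using deflate_fixed[OF y(1) that] by (simp_all add: u'_def)
    show a: "u i \<bullet> (J *v v') = 0" "v i \<bullet> (J *v v') = 0"
      using 0 positive_definite_sym[OF pd, of _ u'] by (simp_all add: Jv')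
    show "u' \<bullet> (J *v v i) = 0"
      using 0(1) pe_simps[OF that] by (simp add: inner_commute)
    show b: "u' \<bullet> (J *v u i) = 0"
      using 0(2) pe_simps[OF that] by (simp add: inner_commute)
    show "u i \<bullet> (J *v u') = 0" using b inner_J_swap[of "u i" u'] by simp
    show "v' \<bullet> (J *v v i) = 0" using a inner_J_swap[of v' "v i"] by simp
  qed
  show "partial_eigenbasis (insert k F) A (d(k := sqrt l)) (u(k := u')) (v(k := v'))"
    using pe k e Au' Av' self cross unfolding partial_eigenbasis_def e_def[symmetric]
    by (auto simp del: scaleR_minus_left)
qed

end

text \<open>Deflating by the germs already found gives an analytic projection, and an analytic
  eigenvector in its range provides the next pair. Square roots are taken only of functions positive
  at \<open>x\<close>, so analyticity is kept.\<close>

lemma local_partial_eigenbasis: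
  fixes A :: "real \<Rightarrow> real^('n::finite + 'n)^('n + 'n)"
  assumes A: "mat_analytic_at A x" and pd: "\<forall>\<^sub>F t in nhds x. positive_definite (A t)"
  shows "\<exists>d u v. (\<forall>i\<in>F. real_analytic_at (\<lambda>t. d t i) x \<and> vec_analytic_at (\<lambda>t. u t i) x \<and> vec_analytic_at (\<lambda>t. v t i) x) \<and>
    (\<forall>\<^sub>F t in nhds x. partial_eigenbasis F (A t) (d t) (u t) (v t))"
proof (induction F rule: finite_induct[OF finite])
  case 1
  show ?case by (auto simp: partial_eigenbasis_def)
next
  case (2 k F)
  then obtain d u v where duv: "\<And>i. i \<in> F \<Longrightarrow> real_analytic_at (\<lambda>t. d t i) x"
    "\<And>i. i \<in> F \<Longrightarrow> vec_analytic_at (\<lambda>t. u t i) x" "\<And>i. i \<in> F \<Longrightarrow> vec_analytic_at (\<lambda>t. v t i) x"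
    and pe: "\<forall>\<^sub>F t in nhds x. partial_eigenbasis F (A t) (d t) (u t) (v t)" by blast
  note pdx = eventually_nhds_x_imp_x[OF pd] and pex = eventually_nhds_x_imp_x[OF pe]
  define P where "P t = deflate F (A t) (d t) (u t) (v t)" for t
  have dx: "d x i > 0" if "i \<in> F" for i using pe_simps(1)[OF pdx pex that] .
  have P: "mat_analytic_at P x"
    unfolding P_def
      using duv dx by (intro mat_analytic_at_deflate A) (auto simp: less_imp_neq[symmetric])
  have "card F < CARD('n)" using 2 by (intro psubset_card_mono) auto
  then have Px: "P x \<noteq> 0" unfolding P_def by (rule deflate_nonzero[OF pdx pex])
  have T: "mat_analytic_at (\<lambda>t. neg_square (A t)) x"
    unfolding neg_square_def
      by (intro mat_analytic_at_scaleR mat_analytic_at_mult mat_analytic_at_const A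
        real_analytic_at_const)
  have "\<forall>\<^sub>F t in nhds x. positive_definite (A t) \<and> selfadjoint (A t) (neg_square (A t))"
    using pd by eventually_elim (simp add: selfadjoint_neg_square)
  moreover have "\<forall>\<^sub>F t in nhds x. compatible (A t) (neg_square (A t)) (P t) (P t)"
    using pd pe unfolding P_def by eventually_elim (rule deflate_compatible)
  ultimately obtain y l where y: "vec_analytic_at y x" and l: "real_analytic_at l x" and yx:
    "y x \<noteq> 0"
    and ev: "\<forall>\<^sub>F t in nhds x. P t *v y t = y t \<and> neg_square (A t) *v y t = l t *\<^sub>R y t"
    using selfadjoint_analytic_eigenvector[OF A T _ P Px] by blast
  have lx: "l x > 0"
    using partial_eigenbasis_insert(1)[OF pdx pex 2(2) _ _ yx] eventually_nhds_x_imp_x[OF ev]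
    unfolding P_def by blast
  define s where "s t = y t \<bullet> (A t *v y t)" for t
  have s: "real_analytic_at s x"
    unfolding s_def by (intro real_analytic_at_inner vec_analytic_at_mult y A)
  have sx: "s x > 0" unfolding s_def by (rule positive_definite_pos[OF pdx yx])
  define u' where "u' t = sqrt (sqrt (l t) / s t) *\<^sub>R y t" for t
  define v' where "v' t = (- 1 / sqrt (l t)) *\<^sub>R (J *v (A t *v u' t))" for t
  have sl: "real_analytic_at (\<lambda>t. sqrt (l t)) x" by (rule real_analytic_at_sqrt[OF l lx])
  have u': "vec_analytic_at u' x"
    unfolding u'_def
      using lx sx by (intro vec_analytic_at_scaleR real_analytic_at_sqrt real_analytic_at_divide
        sl s y) auto
  have v': "vec_analytic_at v' x"
    unfolding v'_def
      using lx by (intro vec_analytic_at_scaleR vec_analytic_at_mult mat_analytic_at_const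
        real_analytic_at_divide real_analytic_at_const sl A u') auto
  have "\<forall>\<^sub>F t in nhds x. s t > 0"
    using real_analytic_at_isCont[OF s] sx by (rule isCont_eventually_pos)
  with pd pe ev have "\<forall>\<^sub>F t in nhds x. partial_eigenbasis (insert k F) (A t)
      ((d t)(k := sqrt (l t))) ((u t)(k := u' t)) ((v t)(k := v' t))"
  proof eventually_elim
    case (elim t)
    have "y t \<noteq> 0" using elim(4) by (auto simp: s_def)
    with elim 2(2) show ?case
      unfolding u'_def v'_def s_def P_def by (intro partial_eigenbasis_insert(2)) auto
  qed
  moreover have "\<forall>i\<in>insert k F. real_analytic_at (\<lambda>t. ((d t)(k := sqrt (l t))) i) x \<and>
      vec_analytic_at (\<lambda>t. ((u t)(k := u' t)) i) x \<and> vec_analytic_at (\<lambda>t. ((v t)(k := v' t)) i) x"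
  proof
    fix i assume "i \<in> insert k F"
    then show "real_analytic_at (\<lambda>t. ((d t)(k := sqrt (l t))) i) x \<and>
      vec_analytic_at (\<lambda>t. ((u t)(k := u' t)) i) x \<and> vec_analytic_at (\<lambda>t. ((v t)(k := v' t)) i) x"
      using duv sl u' v' by (cases "i = k") auto
  qed
  ultimately show ?case by (intro exI conjI) assumption+
qed

lemma partial_eigenbasis_UNIV:
  "partial_eigenbasis UNIV A d u v \<longleftrightarrow> (\<forall>i. 0 < d i) \<and> symplectic_eigenbasis A d u v"
  unfolding partial_eigenbasis_def symplectic_eigenbasis_def symplectic_basis_def by blast

lemma local_symplectic_eigenbasis:
  fixes A :: "real \<Rightarrow> real^('n::finite + 'n)^('n + 'n)"
  assumes "mat_analytic_at A x" "\<forall>\<^sub>F t in nhds x. positive_definite (A t)"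
  shows "\<exists>d u v. (\<forall>i. real_analytic_at (\<lambda>t. d t i) x \<and> vec_analytic_at (\<lambda>t. u t i) x \<and> vec_analytic_at (\<lambda>t. v t i) x) \<and>
    (\<forall>\<^sub>F t in nhds x. (\<forall>i. 0 < d t i) \<and> symplectic_eigenbasis (A t) (d t) (u t) (v t))"
  using local_partial_eigenbasis[OF assms, of UNIV] by (simp add: partial_eigenbasis_UNIV)

section \<open>Uniqueness of symplectic eigenvalues\<close>

text \<open>Read along the increasing list of indices, both functions become sorted lists with the
  same entries.\<close>

lemma mono_eq_of_image_mset_eq:
  fixes f g :: "'n::{finite,linorder} \<Rightarrow> real"
  assumes "mono f" "mono g" "image_mset f (mset_set UNIV) = image_mset g (mset_set UNIV)"
  shows "f = g"
proof -
  define xs :: "'n list" where "xs = sorted_list_of_set UNIV"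
  have xs: "sorted xs" "set xs = UNIV" "distinct xs" by (auto simp: xs_def)
  then have m: "mset xs = mset_set UNIV" by (metis mset_set_set)
  have s: "sorted (map h xs)" if "mono h" for h :: "'n \<Rightarrow> real"
    unfolding sorted_map by (rule sorted_wrt_mono_rel[OF _ xs(1)]) (use that in \<open>auto dest: monoD\<close>)
  have "mset (map f xs) = mset (map g xs)" using assms(3) by (simp add: m)
  then have "map f xs = map g xs"
    by (metis properties_for_sort s assms(1,2))
  then show ?thesis using xs(2) by (auto simp: map_eq_conv)
qed

text \<open>The basis vectors are the columns of \<open>M\<close>, so the entries of
  \<open>transpose M ** X ** M\<close> are pairings of them through \<open>X\<close>, for
  \<open>X = J\<close> and \<open>X = A\<close>.\<close>

lemma symplectic_eigenbasis_matrix: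
  fixes A :: "real^('n::finite + 'n)^('n + 'n)"
  assumes "symplectic_eigenbasis A d u v"
  shows "\<exists>M. symplectic M \<and> transpose M ** A ** M = block_matrix (diagonal d) 0 0 (diagonal d)"
proof -
  define w where "w b = (case b of Inl k \<Rightarrow> u k | Inr k \<Rightarrow> v k)" for b
  define M where "M = (\<chi> i j. w j $ i)"
  have entry: "(transpose M ** X ** M) $ a $ b = w a \<bullet> (X *v w b)" for X a b
  proof -
    have "(transpose M ** X ** M) $ a $ b = (\<Sum>k\<in>UNIV. w a $ k * (X ** M) $ k $ b)"
      unfolding matrix_mul_assoc[symmetric]
      by (subst matrix_matrix_mult_def) (simp add: transpose_def M_def)
    moreover have "(X ** M) $ k $ b = (X *v w b) $ k" for k
      by (simp add: matrix_matrix_mult_def matrix_vector_mult_def M_def)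
    ultimately show ?thesis by (simp add: inner_vec_def)
  qed
  note b = assms[unfolded symplectic_eigenbasis_def symplectic_basis_def]
  have uv: "v i \<bullet> (J *v u j) = (if i = j then - 1 else 0)" for i j
    using b inner_J_swap[of "v i" "u j"] by auto
  have "(transpose M ** J ** M) $ a $ c = J $ a $ c" for a c
    unfolding entry using b uv
    by (cases a; cases c) (auto simp: w_def J_def block_matrix_def mat_def)
  moreover have "(transpose M ** A ** M) $ a $ c =
      block_matrix (diagonal d) 0 0 (diagonal d) $ a $ c" for a c
    unfolding entry using b uv
    by (cases a; cases c) (auto simp: w_def diagonal_def block_matrix_def)
  ultimately show ?thesis unfolding symplectic_def by (intro exI[of _ M]) (simp add: vec_eq_iff)
qed

text \<open>Conjugation by \<open>M\<close> turns \<open>J ** A\<close> into \<open>J ** D\<close>,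
  hence \<open>neg_square A\<close> into a diagonal matrix with each \<open>d k * d k\<close>
  occurring in both blocks.\<close>

lemma det_neg_square:
  fixes A :: "real^('n::finite + 'n)^('n + 'n)"
  assumes M: "symplectic M" and D:
    "transpose M ** A ** M = block_matrix (diagonal d) 0 0 (diagonal d)"
  shows "det (neg_square A - c *\<^sub>R mat 1) = (\<Prod>k\<in>UNIV. d k * d k - c)\<^sup>2"
proof -
  define D where "D = block_matrix (diagonal d) 0 0 (diagonal d)"
  define dd where "dd i = (case i of Inl k \<Rightarrow> d k | Inr k \<Rightarrow> d k)" for i
  \<comment> \<open>Since \<open>J\<close> squares to minus the identity, symplecticity of
    \<open>M\<close> makes this its inverse.\<close>
  define N where "N = - 1 *\<^sub>R (J ** transpose M ** J)"
  have JJ: "J ** J = - 1 *\<^sub>R (mat 1 :: real^('n + 'n)^('n + 'n))"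
  proof -
    have "(J ** J) *v x = (- 1 *\<^sub>R mat 1) *v (x :: real^('n + 'n))" for x
      unfolding matrix_vector_mul_assoc[symmetric] scaleR_matrix_vector_assoc[symmetric] by simp
    then show ?thesis by (simp only: matrix_eq) simp
  qed
  have "N ** M = - 1 *\<^sub>R (J ** (transpose M ** J ** M))"
    by (simp only: N_def matrix_scaleR_left matrix_mul_assoc)
  also have "\<dots> = mat 1" using M unfolding symplectic_def by (simp add: JJ)
  finally have NM: "N ** M = mat 1" .
  then have MN: "M ** N = mat 1" by (simp add: matrix_left_right_inverse)
  have NJ: "N ** J = J ** transpose M"
  proof -
    have "N ** J = - 1 *\<^sub>R (J ** transpose M ** (J ** J))"
      by (simp only: N_def matrix_scaleR_left matrix_mul_assoc)
    then show ?thesis by (simp only: JJ matrix_scaleR_right) simp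
  qed
  have NAM: "N ** (J ** A) ** M = J ** D"
  proof -
    have "N ** (J ** A) ** M = (N ** J) ** A ** M" by (simp only: matrix_mul_assoc)
    also have "\<dots> = J ** (transpose M ** A ** M)" by (simp only: NJ matrix_mul_assoc)
    finally show ?thesis unfolding D D_def .
  qed
  have "N ** neg_square A ** M = - 1 *\<^sub>R (N ** (J ** A) ** (mat 1) ** (J ** A) ** M)"
    by (simp only: neg_square_def matrix_scaleR_left matrix_scaleR_right matrix_mul_assoc
      matrix_mul_rid)
  also have "\<dots> = - 1 *\<^sub>R ((N ** (J ** A) ** M) ** (N ** (J ** A) ** M))"
    by (simp only: MN[symmetric] matrix_mul_assoc)
  also have "\<dots> = neg_square D" by (simp only: NAM neg_square_def)
  finally have conj: "N ** (neg_square A - c *\<^sub>R mat 1) ** M = neg_square D - c *\<^sub>R mat 1"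
    by (simp only: matrix_diff_ldistrib matrix_diff_rdistrib matrix_scaleR_left matrix_scaleR_right
        matrix_mul_rid NM)
  have Dm: "(D *v x) $ i = dd i * x $ i" for x i
    by (cases i) (simp_all add: D_def dd_def matrix_vector_mult_def sum_UNIV_Plus block_matrix_def
        diagonal_def if_distrib[where f = "\<lambda>c. c * _"] cong: if_cong)
  define W where "W = neg_square D - c *\<^sub>R mat 1"
  have Wm: "(W *v x) $ i = (dd i * dd i - c) * x $ i" for x i
    by (cases i) (simp_all add: W_def neg_square_mult matrix_vector_mult_diff_rdistrib
        scaleR_matrix_vector_assoc[symmetric] Dm dd_def algebra_simps)
  have W: "W = (\<chi> i j. if i = j then dd i * dd i - c else 0)"
  proof -
    have "W *v x = (\<chi> i j. if i = j then dd i * dd i - c else 0) *v x" for x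
      by (simp add: vec_eq_iff Wm) (simp add: matrix_vector_mult_def
        if_distrib[where f = "\<lambda>c. c * _"] cong: if_cong)
    then show ?thesis by (simp add: matrix_eq)
  qed
  have "det (neg_square A - c *\<^sub>R mat 1) = det N * det (neg_square A - c *\<^sub>R mat 1) * det M"
    using arg_cong[OF NM, of det] by (simp add: det_mul det_I)
  also have "\<dots> = det W" by (simp add: W_def conj[symmetric] det_mul)
  also have "\<dots> = (\<Prod>i\<in>UNIV. dd i * dd i - c)" by (subst det_diagonal) (simp_all add: W)
  also have "\<dots> = (\<Prod>k\<in>UNIV. d k * d k - c)\<^sup>2"
    unfolding UNIV_Plus_UNIV[symmetric] by (subst prod.Plus) (simp_all add: dd_def power2_eq_square)
  finally show ?thesis .
qed

lemma sum_singleton_mset: "finite S \<Longrightarrow> (\<Sum>k\<in>S. {#f k#}) = image_mset f (mset_set S)"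
  by (induction S rule: finite_induct) auto

text \<open>The determinants determine a polynomial whose roots are the \<open>d k * d k\<close>
  with doubled multiplicity. Halving multiplicities and taking positive roots recovers the multiset
  of values, and monotonicity their order.\<close>

lemma symplectic_eigenvalues_unique:
  fixes A :: "real^('n::{finite,linorder} + 'n)^('n + 'n)"
  assumes "symplectic M" "transpose M ** A ** M = block_matrix (diagonal d) 0 0 (diagonal d)"
    and "symplectic M'" "transpose M' ** A ** M' = block_matrix (diagonal d') 0 0 (diagonal d')"
    and pos: "\<And>j. 0 < d j" "\<And>j. 0 < d' j" and "mono d" "mono d'"
  shows "d = d'"
proof -
  define p where "p f = (\<Prod>k\<in>UNIV. [:- (f k * f k), 1:])\<^sup>2" for f :: "'n \<Rightarrow> real"
  have poly_p: "poly (p f) c = (\<Prod>k\<in>UNIV. f k * f k - c)\<^sup>2" for f c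
  proof -
    \<comment> \<open>The linear factors of \<open>p\<close> have the opposite sign to those of the
      determinant; the square absorbs it.\<close>
    have "poly (p f) c = (\<Prod>k\<in>UNIV. - 1 * (f k * f k - c))\<^sup>2"
      by (simp add: p_def poly_prod poly_power algebra_simps)
    also have "\<dots> = (\<Prod>k\<in>UNIV. f k * f k - c)\<^sup>2"
      unfolding prod.distrib
        by (simp add: power_mult_distrib power_mult[symmetric] mult.commute[of _ 2] power_mult)
    finally show ?thesis .
  qed
  have "poly (p d) c = poly (p d') c" for c
    unfolding poly_p det_neg_square[OF assms(1,2), symmetric] det_neg_square[OF assms(3,4),
      symmetric] ..
  then have "p d = p d'" by (simp add: poly_eq_poly_eq_iff[symmetric] fun_eq_iff)
  moreover have "proots (p f) = repeat_mset 2 (image_mset (\<lambda>k. f k * f k) (mset_set UNIV))" for f ::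
    "'n \<Rightarrow> real"
  proof -
    have "proots (p f) = repeat_mset 2 (\<Sum>k\<in>UNIV. {#f k * f k#})"
      unfolding p_def proots_power by (subst proots_prod) auto
    then show ?thesis by (simp add: sum_singleton_mset)
  qed
  ultimately have "repeat_mset 2 (image_mset (\<lambda>k. d k * d k) (mset_set UNIV)) =
      repeat_mset 2 (image_mset (\<lambda>k. d' k * d' k) (mset_set UNIV))" by metis
  then have "image_mset (\<lambda>k. d k * d k) (mset_set UNIV) = image_mset (\<lambda>k. d' k * d' k) (mset_set UNIV)"
    by (auto simp: multiset_eq_iff)
  then have "image_mset sqrt (image_mset (\<lambda>k. d k * d k) (mset_set UNIV)) =
      image_mset sqrt (image_mset (\<lambda>k. d' k * d' k) (mset_set UNIV))" by simp
  then have "image_mset d (mset_set UNIV) = image_mset d' (mset_set UNIV)"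
    using pos by (simp add: multiset.map_comp o_def less_imp_le)
  with assms(7,8) show ?thesis by (rule mono_eq_of_image_mset_eq)
qed

lemma symplectic_eigenvalues_eq:
  fixes A :: "real^('n::{finite,linorder} + 'n)^('n + 'n)"
  assumes "symplectic_eigenbasis A d u v" "\<And>j. 0 < d j" "mono d"
  shows "symplectic_eigenvalues A = d"
  unfolding symplectic_eigenvalues_def
proof (rule the_equality)
  show "(\<forall>j. 0 < d j) \<and> mono d \<and>
     (\<exists>M. symplectic M \<and> transpose M ** A ** M = block_matrix (diagonal d) 0 0 (diagonal d))"
    using assms symplectic_eigenbasis_matrix by blast
  then show "d' = d" if "(\<forall>j. 0 < d' j) \<and> mono d' \<and>
     (\<exists>M. symplectic M \<and> transpose M ** A ** M = block_matrix (diagonal d') 0 0 (diagonal d'))" for d'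
    using that symplectic_eigenvalues_unique by blast
qed

section \<open>Sorting and gluing\<close>

text \<open>The real coefficients of each entry define a complex power series on the complex ball of
  the same radius, and its sum is the required extension.\<close>

lemma real_analytic_on_imp_mat_analytic_at:
  assumes "real_analytic_on A I" "x \<in> I" shows "mat_analytic_at A x"
  unfolding mat_analytic_at_def
proof (intro allI)
  fix i j
  obtain c r where r: "r > 0" and c: "\<And>y. \<bar>y - x\<bar> < r \<Longrightarrow> (\<lambda>k. (y - x) ^ k *\<^sub>R c k) sums A y"
    using assms unfolding real_analytic_on_def by blast
  define a where "a k = complex_of_real (c k $ i $ j)" for k
  have real_sums: "(\<lambda>k. a k * complex_of_real (y - x) ^ k) sums of_real (A y $ i $ j)" if
    "\<bar>y - x\<bar> < r" for y
  proof -
    have "(\<lambda>k. ((y - x) ^ k *\<^sub>R c k) $ i $ j) sums (A y $ i $ j)"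
      using c[OF that] unfolding sums_def
      by (auto dest!: tendsto_vec_nth[of _ _ _ i] tendsto_vec_nth[of _ _ _ j] simp: sum_component)
    then have "(\<lambda>k. complex_of_real (((y - x) ^ k *\<^sub>R c k) $ i $ j)) sums of_real (A y $ i $ j)"
      by (rule sums_of_real)
    then show ?thesis by (simp add: a_def mult.commute)
  qed
  define F where "F z = (\<Sum>k. a k * (z - of_real x) ^ k)" for z
  have "(\<lambda>k. a k * (z - of_real x) ^ k) sums F z" if "z \<in> ball (complex_of_real x) r" for z
  proof -
    \<comment> \<open>Chosen strictly between the distance of \<open>z\<close> from the centre and
      \<open>r\<close>: convergence at the real point \<open>x + \<rho>\<close> implies convergence
      at \<open>z\<close>.\<close>
    define \<rho> where "\<rho> = (norm (z - of_real x) + r) / 2"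
    have "norm (z - of_real x) < r" using that by (simp add: dist_norm norm_minus_commute)
    then have \<rho>: "norm (z - of_real x) < \<rho>" "\<rho> < r" "0 < \<rho>"
      using r by (auto simp: \<rho>_def add_nonneg_pos)
    have "summable (\<lambda>k. a k * complex_of_real \<rho> ^ k)"
      using real_sums[of "x + \<rho>"] \<rho> by (auto simp: sums_iff)
    then have "summable (\<lambda>k. a k * (z - of_real x) ^ k)"
      by (rule powser_inside) (use \<rho> in simp)
    then show ?thesis unfolding F_def by (rule summable_sums)
  qed
  then have hol: "F holomorphic_on ball (complex_of_real x) r" by (rule power_series_holomorphic)
  then have "F analytic_on {complex_of_real x}"
    using r by (subst analytic_at) (metis centre_in_ball open_ball)
  moreover have "\<forall>\<^sub>F t in nhds x. t \<in> ball x r"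
    using r by (intro eventually_nhds_in_open) auto
  then have "\<forall>\<^sub>F t in nhds x. complex_of_real (A t $ i $ j) = F (of_real t)"
  proof eventually_elim
    case (elim t)
    then have "\<bar>t - x\<bar> < r" by (simp add: dist_real_def abs_minus_commute)
    from real_sums[OF this] show ?case by (simp add: F_def sums_iff)
  qed
  ultimately show "real_analytic_at (\<lambda>t. A t $ i $ j) x" unfolding real_analytic_at_def by blast
qed

text \<open>The real parts of the Taylor coefficients of the extension serve, within a radius where
  it is holomorphic and agrees with \<open>f\<close>.\<close>

lemma real_analytic_at_power_series:
  assumes "real_analytic_at f x"
  shows "\<exists>c r. r > 0 \<and> (\<forall>y. \<bar>y - x\<bar> < r \<longrightarrow> (\<lambda>k. (y - x) ^ k * c k) sums f y)"
proof -
  obtain F where F: "F analytic_on {complex_of_real x}"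
    and e: "\<forall>\<^sub>F t in nhds x. complex_of_real (f t) = F (of_real t)"
    using assms unfolding real_analytic_at_def by blast
  obtain r where r: "r > 0" "F holomorphic_on ball (complex_of_real x) r"
    using F analytic_at_ball by blast
  obtain r' where r': "r' > 0" "\<And>t. dist t x < r' \<Longrightarrow> complex_of_real (f t) = F (of_real t)"
    using e unfolding eventually_nhds_metric by blast
  define a where "a n = (deriv ^^ n) F (of_real x) / fact n" for n
  have "(\<lambda>k. (y - x) ^ k * Re (a k)) sums f y" if "\<bar>y - x\<bar> < min r r'" for y
  proof -
    have "complex_of_real y \<in> ball (of_real x) r"
      using that by (simp add: dist_norm abs_minus_commute flip: of_real_diff)
    from holomorphic_power_series[OF r(2) this]
    have "(\<lambda>k. a k * complex_of_real ((y - x) ^ k)) sums of_real (f y)"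
      using r'(2)[of y] that by (simp add: a_def dist_real_def)
    from sums_Re[OF this] show ?thesis by (simp add: mult.commute del: of_real_power of_real_diff)
  qed
  then show ?thesis using r(1) r'(1) by (intro exI[of _ "\<lambda>k. Re (a k)"] exI[of _ "min r r'"]) auto
qed

lemma real_analytic_onI_real_analytic_at:
  assumes "\<And>x. x \<in> U \<Longrightarrow> real_analytic_at f x" shows "real_analytic_on f U"
  unfolding real_analytic_on_def
proof
  fix x assume "x \<in> U"
  from real_analytic_at_power_series[OF assms[OF this]]
  show "\<exists>c. \<exists>r>0. \<forall>y. \<bar>y - x\<bar> < r \<longrightarrow> (\<lambda>k. (y - x) ^ k *\<^sub>R c k) sums f y" by auto
qed

lemma real_analytic_onI_vec_analytic_at:
  fixes f :: "real \<Rightarrow> real^'m"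
  assumes "\<And>x. x \<in> U \<Longrightarrow> vec_analytic_at f x" shows "real_analytic_on f U"
  unfolding real_analytic_on_def
proof
  fix x assume "x \<in> U"
  then have "real_analytic_at (\<lambda>t. f t $ i) x" for i
    using assms unfolding vec_analytic_at_def by blast
  then have "\<forall>i. \<exists>p. snd p > 0 \<and> (\<forall>y. \<bar>y - x\<bar> < snd p \<longrightarrow> (\<lambda>k. (y - x) ^ k * fst p k) sums (f y $ i))"
    using real_analytic_at_power_series by fastforce
  then obtain p where p: "\<forall>i. snd (p i) > 0 \<and>
      (\<forall>y. \<bar>y - x\<bar> < snd (p i) \<longrightarrow> (\<lambda>k. (y - x) ^ k * fst (p i) k) sums (f y $ i))"
    by (rule exE[OF choice])
  define r where "r = Min (range (\<lambda>i. snd (p i)))"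
  have r: "r > 0" "\<And>i. r \<le> snd (p i)" using p by (auto simp: r_def)
  define c where "c k = (\<chi> i. fst (p i) k)" for k
  have "(\<lambda>k. (y - x) ^ k *\<^sub>R c k) sums f y" if "\<bar>y - x\<bar> < r" for y
    unfolding sums_def
  proof (intro vec_tendstoI)
    fix i
    have "(\<lambda>k. (y - x) ^ k * fst (p i) k) sums (f y $ i)" using p that r(2)[of i] by auto
    then show "((\<lambda>n. (\<Sum>k<n. (y - x) ^ k *\<^sub>R c k) $ i) \<longlonglongrightarrow> f y $ i)"
      by (simp add: sums_def c_def sum_component)
  qed
  with r(1) show "\<exists>c. \<exists>r>0. \<forall>y. \<bar>y - x\<bar> < r \<longrightarrow> (\<lambda>k. (y - x) ^ k *\<^sub>R c k) sums f y" by blast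
qed

section \<open>Sorting the eigenvalue branches\<close>

lemma sorting_permutation:
  fixes f :: "'n::{finite,linorder} \<Rightarrow> real"
  shows "\<exists>\<sigma> :: 'n \<Rightarrow> 'n. inj \<sigma> \<and> mono (f \<circ> \<sigma>)"
proof -
  define ys where "ys = sort_key f (sorted_list_of_set (UNIV :: 'n set))"
  have ys: "sorted (map f ys)" "distinct ys" "length ys = CARD('n)"
    by (auto simp: ys_def)
  \<comment> \<open>The rank of \<open>j\<close> counted from 0, hence a valid index into
    \<open>ys\<close>.\<close>
  define pos where "pos j = card {k. k < j}" for j :: 'n
  have pos_less: "pos j < CARD('n)" for j
    unfolding pos_def by (intro psubset_card_mono) (auto simp: psubset_eq)
  have pos_mono: "pos j < pos k" if "j < k" for j k
    unfolding pos_def using that by (intro psubset_card_mono) (auto simp: psubset_eq)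
  define \<sigma> where "\<sigma> j = ys ! pos j" for j
  have "inj \<sigma>"
  proof (rule injI)
    fix j k assume "\<sigma> j = \<sigma> k"
    then have "pos j = pos k" using ys pos_less by (simp add: \<sigma>_def nth_eq_iff_index_eq)
    then show "j = k"
      using pos_mono[of j k] pos_mono[of k j] by (cases j k rule: linorder_cases) auto
  qed
  moreover have "mono (f \<circ> \<sigma>)"
  proof (rule monoI)
    fix j k :: 'n assume "j \<le> k"
    then have "pos j \<le> pos k" using pos_mono[of j k] by (auto simp: le_less)
    then have "map f ys ! pos j \<le> map f ys ! pos k"
      using ys pos_less by (intro sorted_nth_mono) auto
    then show "(f \<circ> \<sigma>) j \<le> (f \<circ> \<sigma>) k" using ys pos_less by (simp add: \<sigma>_def)
  qed
  ultimately show ?thesis by blast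
qed

text \<open>Finitely many comparisons each settle along \<open>G\<close>, so the whole pattern of
  comparisons is eventually constant. A permutation sorting the values at one such \<open>t0\<close>
  then sorts them eventually.\<close>

lemma eventually_sorted:
  fixes d :: "real \<Rightarrow> 'n::{finite,linorder} \<Rightarrow> real"
  assumes G: "G \<noteq> bot"
    and sign: "\<And>i j. (\<forall>\<^sub>F t in G. d t i - d t j = 0) \<or> (\<forall>\<^sub>F t in G. d t i - d t j > 0) \<or>
      (\<forall>\<^sub>F t in G. d t i - d t j < 0)"
  shows "\<exists>\<sigma> :: 'n \<Rightarrow> 'n. inj \<sigma> \<and> (\<forall>\<^sub>F t in G. mono (d t \<circ> \<sigma>))"
proof -
  define S where "S i j \<longleftrightarrow> (\<forall>\<^sub>F t in G. d t i \<le> d t j)" for i j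
  have "\<forall>\<^sub>F t in G. S i j \<longleftrightarrow> d t i \<le> d t j" for i j
  proof (cases "\<forall>\<^sub>F t in G. d t i - d t j > 0")
    case True
    have "\<not> S i j"
    proof
      assume "S i j"
      with True have "\<forall>\<^sub>F t in G. False" unfolding S_def by eventually_elim simp
      with G show False by simp
    qed
    with True show ?thesis by (auto elim: eventually_mono)
  next
    case False
    with sign[of i j] have "S i j" unfolding S_def by (auto elim: eventually_mono)
    then show ?thesis unfolding S_def by (auto elim: eventually_mono)
  qed
  then have ev: "\<forall>\<^sub>F t in G. \<forall>i\<in>UNIV. \<forall>j\<in>UNIV. S i j \<longleftrightarrow> d t i \<le> d t j"
    by (intro eventually_ball_finite ballI finite)
  then obtain t0 where t0: "\<And>i j. S i j \<longleftrightarrow> d t0 i \<le> d t0 j"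
    using eventually_happens'[OF G] by blast
  obtain \<sigma> :: "'n \<Rightarrow> 'n" where \<sigma>: "inj \<sigma>" "mono (d t0 \<circ> \<sigma>)" using sorting_permutation by blast
  have "\<forall>\<^sub>F t in G. mono (d t \<circ> \<sigma>)"
    using ev by eventually_elim (use \<sigma>(2) t0 in \<open>auto simp: mono_def\<close>)
  with \<sigma>(1) show ?thesis by blast
qed

lemma symplectic_eigenbasis_permute:
  assumes "inj \<sigma>" "symplectic_eigenbasis A d u v"
  shows "symplectic_eigenbasis A (d \<circ> \<sigma>) (u \<circ> \<sigma>) (v \<circ> \<sigma>)"
  using assms unfolding symplectic_eigenbasis_def symplectic_basis_def by (simp add: inj_eq)

definition sorted_eigenbasis ::
  "real^('n::{finite,linorder} + 'n)^('n + 'n) \<Rightarrow> ('n \<Rightarrow> real) \<Rightarrow>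
     ('n \<Rightarrow> real^('n + 'n)) \<Rightarrow> ('n \<Rightarrow> real^('n + 'n)) \<Rightarrow> bool" where
  "sorted_eigenbasis A d u v \<longleftrightarrow> (\<forall>i. 0 < d i) \<and> mono d \<and> symplectic_eigenbasis A d u v"

text \<open>Analyticity is demanded around the closed interval, but sortedness only inside the open
  one, since continued branches may cross at an end point.\<close>

definition analytic_eigenbasis_on ::
  "(real \<Rightarrow> real^('n::{finite,linorder} + 'n)^('n + 'n)) \<Rightarrow> real \<Rightarrow> real \<Rightarrow>
    (real \<Rightarrow> 'n \<Rightarrow> real) \<Rightarrow> (real \<Rightarrow> 'n \<Rightarrow> real^('n + 'n)) \<Rightarrow> (real \<Rightarrow> 'n \<Rightarrow> real^('n + 'n)) \<Rightarrow> bool" where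
  "analytic_eigenbasis_on A p q d u v \<longleftrightarrow>
    (\<exists>U. open U \<and> {p..q} \<subseteq> U \<and> (\<forall>i. real_analytic_on (\<lambda>t. d t i) U \<and>
       real_analytic_on (\<lambda>t. u t i) U \<and> real_analytic_on (\<lambda>t. v t i) U)) \<and>
    (\<forall>t\<in>{p<..<q}. sorted_eigenbasis (A t) (d t) (u t) (v t))"

text \<open>The same analytic branches are rearranged by one permutation to the right of
  \<open>x\<close>, one to the left, and one at \<open>x\<close> itself.\<close>

lemma local_sorted_eigenbasis:
  fixes A :: "real \<Rightarrow> real^('n::{finite,linorder} + 'n)^('n + 'n)"
  assumes A: "mat_analytic_at A x" and pd: "\<forall>\<^sub>F t in nhds x. positive_definite (A t)"
  shows "\<exists>e>0. (\<forall>q. x < q \<and> q < x + e \<longrightarrow> (\<exists>d u v. analytic_eigenbasis_on A x q d u v)) \<and>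
    (\<forall>p. x - e < p \<and> p < x \<longrightarrow> (\<exists>d u v. analytic_eigenbasis_on A p x d u v))"
    and "\<exists>d u v. sorted_eigenbasis (A x) d u v"
proof -
  obtain d u v where duv: "\<And>i. real_analytic_at (\<lambda>t. d t i) x" "\<And>i. vec_analytic_at (\<lambda>t. u t i) x"
    "\<And>i. vec_analytic_at (\<lambda>t. v t i) x"
    and eb: "\<forall>\<^sub>F t in nhds x. (\<forall>i. 0 < d t i) \<and> symplectic_eigenbasis (A t) (d t) (u t) (v t)"
    using local_symplectic_eigenbasis[OF A pd] by blast
  obtain \<sigma>0 :: "'n \<Rightarrow> 'n" where "inj \<sigma>0" "mono (d x \<circ> \<sigma>0)" using sorting_permutation by blast
  then have "sorted_eigenbasis (A x) (d x \<circ> \<sigma>0) (u x \<circ> \<sigma>0) (v x \<circ> \<sigma>0)"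
    using eventually_nhds_x_imp_x[OF eb] symplectic_eigenbasis_permute
    unfolding sorted_eigenbasis_def by auto
  then show "\<exists>d u v. sorted_eigenbasis (A x) d u v" by blast
  have ev_v: "\<forall>\<^sub>F t in nhds x. vec_analytic_at f t" if "vec_analytic_at f x" for f ::
    "real \<Rightarrow> real^('n + 'n)"
  proof -
    have "\<forall>\<^sub>F t in nhds x. \<forall>i\<in>UNIV. real_analytic_at (\<lambda>t. f t $ i) t"
      using that
        unfolding vec_analytic_at_def by (intro eventually_ball_finite ballI finite
          real_analytic_at_eventually) auto
    then show ?thesis by (simp add: vec_analytic_at_def)
  qed
  have "\<forall>\<^sub>F t in nhds x. \<forall>i\<in>UNIV. real_analytic_at (\<lambda>t. d t i) t"
    "\<forall>\<^sub>F t in nhds x. \<forall>i\<in>UNIV. vec_analytic_at (\<lambda>t. u t i) t"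
    "\<forall>\<^sub>F t in nhds x. \<forall>i\<in>UNIV. vec_analytic_at (\<lambda>t. v t i) t"
    by (intro eventually_ball_finite ballI finite real_analytic_at_eventually ev_v duv)+
  with eb have "\<forall>\<^sub>F t in nhds x. (\<forall>i. real_analytic_at (\<lambda>t. d t i) t \<and> vec_analytic_at (\<lambda>t. u t i) t \<and> vec_analytic_at (\<lambda>t. v t i) t) \<and>
      (\<forall>i. 0 < d t i) \<and> symplectic_eigenbasis (A t) (d t) (u t) (v t)"
    by eventually_elim blast
  then obtain e0 where e0: "e0 > 0" and near: "\<And>t. dist t x < e0 \<Longrightarrow>
      (\<forall>i. real_analytic_at (\<lambda>t. d t i) t \<and> vec_analytic_at (\<lambda>t. u t i) t \<and> vec_analytic_at (\<lambda>t.
        v t i) t) \<and>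
      (\<forall>i. 0 < d t i) \<and> symplectic_eigenbasis (A t) (d t) (u t) (v t)"
    unfolding eventually_nhds_metric by blast
  \<comment> \<open>A constant permutation preserves analyticity on the whole ball; only the order
    of the eigenvalues needs the smaller interval.\<close>
  have piece: "analytic_eigenbasis_on A p q (\<lambda>t. d t \<circ> \<sigma>) (\<lambda>t. u t \<circ> \<sigma>) (\<lambda>t. v t \<circ> \<sigma>)"
    if "inj \<sigma>" and sub: "{p..q} \<subseteq> ball x e0" and "\<forall>t\<in>{p<..<q}. mono (d t \<circ> \<sigma>)" for p q \<sigma>
    unfolding analytic_eigenbasis_on_def
  proof (intro conjI exI[of _ "ball x e0"] allI ballI)
    have "\<And>t i. t \<in> ball x e0 \<Longrightarrow> real_analytic_at (\<lambda>t. d t i) t \<and> vec_analytic_at (\<lambda>t. u t i) t \<and> vec_analytic_at (\<lambda>t. v t i) t"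
      using near by (simp add: dist_commute)
    then show "real_analytic_on (\<lambda>t. (d t \<circ> \<sigma>) i) (ball x e0)"
      "real_analytic_on (\<lambda>t. (u t \<circ> \<sigma>) i) (ball x e0)"
        "real_analytic_on (\<lambda>t. (v t \<circ> \<sigma>) i) (ball x e0)" for i
      by (auto intro!: real_analytic_onI_real_analytic_at real_analytic_onI_vec_analytic_at)
    fix t assume t: "t \<in> {p<..<q}"
    then have "t \<in> {p..q}" by simp
    with sub have "t \<in> ball x e0" by blast
    then have "dist t x < e0" by (simp add: dist_commute)
    from near[OF this] that(1,3) t show "sorted_eigenbasis (A t) (d t \<circ> \<sigma>) (u t \<circ> \<sigma>) (v t \<circ> \<sigma>)"
      unfolding sorted_eigenbasis_def by (auto intro: symplectic_eigenbasis_permute)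
  qed (use sub in auto)
  obtain \<sigma>1 :: "'n \<Rightarrow> 'n" where \<sigma>1: "inj \<sigma>1" "\<forall>\<^sub>F t in at_right x. mono (d t \<circ> \<sigma>1)"
    using eventually_sorted[of "at_right x" d, OF _ real_analytic_at_sign_right[OF real_analytic_at_diff[OF duv(1) duv(1)]]]
      by auto
  obtain \<sigma>2 :: "'n \<Rightarrow> 'n" where \<sigma>2: "inj \<sigma>2" "\<forall>\<^sub>F t in at_left x. mono (d t \<circ> \<sigma>2)"
    using eventually_sorted[of "at_left x" d, OF _ real_analytic_at_sign_left[OF real_analytic_at_diff[OF duv(1) duv(1)]]]
      by auto
  obtain b1 where b1: "b1 > x" "\<And>t. x < t \<Longrightarrow> t < b1 \<Longrightarrow> mono (d t \<circ> \<sigma>1)"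
    using \<sigma>1(2) unfolding eventually_at_right_field by blast
  obtain b2 where b2: "b2 < x" "\<And>t. b2 < t \<Longrightarrow> t < x \<Longrightarrow> mono (d t \<circ> \<sigma>2)"
    using \<sigma>2(2) unfolding eventually_at_left_field by blast
  define e where "e = min e0 (min (b1 - x) (x - b2))"
  have e: "e > 0" "e \<le> e0" "x + e \<le> b1" "b2 \<le> x - e" using e0 b1 b2 by (auto simp: e_def)
  show "\<exists>e>0. (\<forall>q. x < q \<and> q < x + e \<longrightarrow> (\<exists>d u v. analytic_eigenbasis_on A x q d u v)) \<and>
    (\<forall>p. x - e < p \<and> p < x \<longrightarrow> (\<exists>d u v. analytic_eigenbasis_on A p x d u v))"
  proof (intro exI[of _ e] conjI allI impI e(1))
    fix q assume q: "x < q \<and> q < x + e"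
    have "analytic_eigenbasis_on A x q (\<lambda>t. d t \<circ> \<sigma>1) (\<lambda>t. u t \<circ> \<sigma>1) (\<lambda>t. v t \<circ> \<sigma>1)"
      using q e b1(2) by (intro piece \<sigma>1(1)) (auto simp: dist_real_def)
    then show "\<exists>d u v. analytic_eigenbasis_on A x q d u v" by blast
  next
    fix p assume p: "x - e < p \<and> p < x"
    have "analytic_eigenbasis_on A p x (\<lambda>t. d t \<circ> \<sigma>2) (\<lambda>t. u t \<circ> \<sigma>2) (\<lambda>t. v t \<circ> \<sigma>2)"
      using p e b2(2) by (intro piece \<sigma>2(1)) (auto simp: dist_real_def)
    then show "\<exists>d u v. analytic_eigenbasis_on A p x d u v" by blast
  qed
qed

section \<open>Partitions of compact intervals\<close>

definition partitionable :: "(real \<Rightarrow> real \<Rightarrow> bool) \<Rightarrow> real \<Rightarrow> real \<Rightarrow> bool" where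
  "partitionable P a b \<longleftrightarrow> (\<exists>(r::nat) s. s 0 = a \<and> s r = b \<and>
     (\<forall>i<r. s i < s (Suc i) \<and> P (s i) (s (Suc i))))"

lemma partitionable_refl: "partitionable P a a"
  unfolding partitionable_def by (intro exI[of _ 0]) auto

lemma partitionable_single: "a < b \<Longrightarrow> P a b \<Longrightarrow> partitionable P a b"
  unfolding partitionable_def
  by (intro exI[of _ "Suc 0"] exI[of _ "\<lambda>i. if i = 0 then a else b"]) auto

lemma partitionable_trans:
  assumes "partitionable P a b" "partitionable P b c" shows "partitionable P a c"
proof -
  obtain r s where s: "s 0 = a" "s r = b" "\<And>i. i < r \<Longrightarrow> s i < s (Suc i) \<and> P (s i) (s (Suc i))"
    using assms(1) unfolding partitionable_def by blast
  obtain r' s' where s': "s' 0 = b" "s' r' = c"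
    "\<And>i. i < r' \<Longrightarrow> s' i < s' (Suc i) \<and> P (s' i) (s' (Suc i))"
    using assms(2) unfolding partitionable_def by blast
  \<comment> \<open>The two descriptions agree at \<open>i = r\<close>, where both give
    \<open>b\<close>.\<close>
  define w where "w i = (if i \<le> r then s i else s' (i - r))" for i
  have "w i < w (Suc i) \<and> P (w i) (w (Suc i))" if "i < r + r'" for i
  proof (cases i r rule: linorder_cases)
    case less
    then show ?thesis using s by (simp add: w_def)
  next
    case equal
    then show ?thesis using s(2) s'(1) s'(3)[of 0] that by (simp add: w_def)
  next
    case greater
    then show ?thesis using s'(3)[of "i - r"] that by (simp add: w_def Suc_diff_le)
  qed
  moreover have "w 0 = a" "w (r + r') = c" using s s' by (auto simp: w_def)
  ultimately show ?thesis unfolding partitionable_def by blast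
qed

text \<open>Compactness enters through the bisection principle \<open>Bolzano\<close>. A short
  interval around \<open>x\<close> is cut at \<open>x\<close>, because the local hypothesis concerns
  intervals with \<open>x\<close> as an end point.\<close>

lemma partition_compact:
  assumes "a \<le> b" and local: "\<And>x. a \<le> x \<Longrightarrow> x \<le> b \<Longrightarrow>
    \<exists>e>0. (\<forall>q. x < q \<and> q < x + e \<longrightarrow> P x q) \<and> (\<forall>p. x - e < p \<and> p < x \<longrightarrow> P p x)"
  shows "partitionable P a b"
  using assms(1)
proof (induction rule: Bolzano)
  case (trans a b c)
  then show ?case by (blast intro: partitionable_trans)
next
  case (local x)
  from assms(2)[OF this] obtain e where e: "e > 0" "\<And>q. x < q \<Longrightarrow> q < x + e \<Longrightarrow> P x q"
    "\<And>p. x - e < p \<Longrightarrow> p < x \<Longrightarrow> P p x" by blast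
  have "partitionable P p q" if "p \<le> x" "x \<le> q" "q - p < e" for p q
  proof (rule partitionable_trans)
    show "partitionable P p x" using that e(3)[of p]
      by (cases "p = x") (auto intro: partitionable_refl partitionable_single)
    show "partitionable P x q" using that e(2)[of q]
      by (cases "q = x") (auto intro: partitionable_refl partitionable_single)
  qed
  with e(1) show ?case by blast
qed

lemma piecewise_real_analyticI:
  fixes s :: "nat \<Rightarrow> real"
  assumes "s 0 = a" "s r = b" "\<And>i. i < r \<Longrightarrow> s i < s (Suc i)"
    and "\<And>i t. i < r \<Longrightarrow> t \<in> {s i<..<s (Suc i)} \<Longrightarrow> f t = g i t"
    and "\<And>i. i < r \<Longrightarrow> \<exists>W. open W \<and> {s i..s (Suc i)} \<subseteq> W \<and> real_analytic_on (g i) W"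
  shows "piecewise_real_analytic f a b"
  unfolding piecewise_real_analytic_def
proof (rule exI[of _ r], rule exI[of _ s], intro conjI allI impI)
  fix i assume i: "i < r"
  obtain W where W: "open W" "{s i..s (Suc i)} \<subseteq> W" "real_analytic_on (g i) W"
    using assms(5)[OF i] by blast
  moreover have "\<forall>t\<in>{s i<..<s (Suc i)}. f t = g i t" using assms(4)[OF i] by blast
  ultimately show "\<exists>g U. open U \<and> {s i..s (Suc i)} \<subseteq> U \<and> real_analytic_on g U \<and>
      (\<forall>t\<in>{s i<..<s (Suc i)}. f t = g t)" by (intro exI conjI) assumption+
qed (use assms in auto)

theorem theorem4p7:
  fixes A :: "real \<Rightarrow> real^('n::{finite,linorder} + 'n)^('n + 'n)"
    and I :: "real set" and a b :: real
  assumes "open I" and "is_interval I"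
    and "\<And>t. t \<in> I \<Longrightarrow> positive_definite (A t)"
    and "real_analytic_on A I"
    and "a \<le> b" and "{a..b} \<subseteq> I"
  shows "(\<forall>j. piecewise_real_analytic (\<lambda>t. symplectic_eigenvalues (A t) j) a b) \<and>
    (\<exists>u v :: real \<Rightarrow> 'n \<Rightarrow> real^('n + 'n).
       (\<forall>t\<in>{a..b}. symplectic_eigenbasis (A t) (symplectic_eigenvalues (A t)) (u t) (v t)) \<and>
       (\<forall>i. piecewise_real_analytic (\<lambda>t. u t i) a b \<and>
            piecewise_real_analytic (\<lambda>t. v t i) a b))"
proof -
  have A: "mat_analytic_at A x" if "x \<in> I" for x
    using real_analytic_on_imp_mat_analytic_at[OF assms(4) that] .
  have pd: "\<forall>\<^sub>F t in nhds x. positive_definite (A t)" if "x \<in> I" for x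
    using eventually_nhds_in_open[OF assms(1) that] by eventually_elim (rule assms(3))
  \<comment> \<open>Each piece carries a complete eigenbasis, so one partition serves all
    eigenvalues and basis vectors at once.\<close>
  have "partitionable (\<lambda>p q. \<exists>d u v. analytic_eigenbasis_on A p q d u v) a b"
    using assms(5)
  proof (rule partition_compact)
    fix x assume "a \<le> x" "x \<le> b"
    then have "x \<in> I" using assms(6) by auto
    from local_sorted_eigenbasis(1)[OF A[OF this] pd[OF this]]
    show "\<exists>e>0. (\<forall>q. x < q \<and> q < x + e \<longrightarrow> (\<exists>d u v. analytic_eigenbasis_on A x q d u v)) \<and>
      (\<forall>p. x - e < p \<and> p < x \<longrightarrow> (\<exists>d u v. analytic_eigenbasis_on A p x d u v))" .
  qed
  then obtain r s where s: "s 0 = a" "s r = b" "\<And>i. i < r \<Longrightarrow> s i < s (Suc i)"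
    and ex: "\<And>i. i < r \<Longrightarrow> \<exists>d u v. analytic_eigenbasis_on A (s i) (s (Suc i)) d u v"
    unfolding partitionable_def by blast
  have "\<forall>i. \<exists>p. i < r \<longrightarrow> analytic_eigenbasis_on A (s i) (s (Suc i)) (fst p) (fst (snd p)) (snd (snd p))"
    using ex by fastforce
  then obtain p where p: "\<forall>i. i < r \<longrightarrow>
      analytic_eigenbasis_on A (s i) (s (Suc i)) (fst (p i)) (fst (snd (p i))) (snd (snd (p i)))"
    by (rule exE[OF choice])
  define D U V where "D i = fst (p i)" and "U i = fst (snd (p i))" and "V i = snd (snd (p i))" for i
  have piece: "analytic_eigenbasis_on A (s i) (s (Suc i)) (D i) (U i) (V i)" if "i < r" for i
    using p that by (simp add: D_def U_def V_def)
  have le: "s i \<le> s j" if "i \<le> j" "j \<le> r" for i j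
    using that
  proof (induction j rule: dec_induct)
    case (step k)
    then show ?case using s(3)[of k] by auto
  qed simp
  have uniq: "i = j" if "i < r" "j < r" "t \<in> {s i<..<s (Suc i)}" "t \<in> {s j<..<s (Suc j)}" for i j t
    using that le[of "Suc i" j] le[of "Suc j" i] by (cases i j rule: linorder_cases) auto
  define idx where "idx t = (THE i. i < r \<and> t \<in> {s i<..<s (Suc i)})" for t
  have idx: "idx t = i" if "i < r" "t \<in> {s i<..<s (Suc i)}" for i t
    unfolding idx_def using that uniq by (intro the_equality) blast+
  \<comment> \<open>Partition points need an eigenbasis too. As no regularity is required there,
    \<open>q\<close> is chosen pointwise.\<close>
  have "\<forall>t. \<exists>q. t \<in> I \<longrightarrow> sorted_eigenbasis (A t) (fst q) (fst (snd q)) (snd (snd q))"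
    using local_sorted_eigenbasis(2)[OF A pd] by fastforce
  then obtain q where q: "\<forall>t. t \<in> I \<longrightarrow> sorted_eigenbasis (A t) (fst (q t)) (fst (snd (q t))) (snd (snd (q t)))"
    by (rule exE[OF choice])
  define inside where "inside t \<longleftrightarrow> (\<exists>i<r. t \<in> {s i<..<s (Suc i)})" for t
  define u where "u t = (if inside t then U (idx t) t else fst (snd (q t)))" for t
  define v where "v t = (if inside t then V (idx t) t else snd (snd (q t)))" for t
  \<comment> \<open>By uniqueness every sorted eigenbasis carries the true symplectic eigenvalues,
    so the branches \<open>D\<close> and the pointwise choice \<open>q\<close> fit together.\<close>
  have val: "symplectic_eigenvalues (A t) = d" if "sorted_eigenbasis (A t) d u v" for t d u v
    using that symplectic_eigenvalues_eq unfolding sorted_eigenbasis_def by blast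
  have sorted: "sorted_eigenbasis (A t) (D i t) (U i t) (V i t)"
    if "i < r" "t \<in> {s i<..<s (Suc i)}" for i t
    using piece[OF that(1)] that(2) unfolding analytic_eigenbasis_on_def by blast
  have on_piece: "symplectic_eigenvalues (A t) = D i t \<and> u t = U i t \<and> v t = V i t"
    if "i < r" "t \<in> {s i<..<s (Suc i)}" for i t
  proof -
    have "inside t" unfolding inside_def using that by blast
    then show ?thesis using val[OF sorted[OF that]] idx[OF that] by (simp add: u_def v_def)
  qed
  have basis: "symplectic_eigenbasis (A t) (symplectic_eigenvalues (A t)) (u t) (v t)" if
    "t \<in> {a..b}" for t
  proof (cases "inside t")
    case True
    then obtain i where i: "i < r" "t \<in> {s i<..<s (Suc i)}" unfolding inside_def by blast
    show ?thesis using on_piece[OF i] sorted[OF i] by (simp add: sorted_eigenbasis_def)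
  next
    case False
    have "sorted_eigenbasis (A t) (fst (q t)) (fst (snd (q t))) (snd (snd (q t)))"
      using q that assms(6) by blast
    with val[OF this] False show ?thesis by (simp add: u_def v_def sorted_eigenbasis_def)
  qed
  have an: "\<exists>W. open W \<and> {s i..s (Suc i)} \<subseteq> W \<and> (\<forall>j. real_analytic_on (\<lambda>t. D i t j) W \<and>
       real_analytic_on (\<lambda>t. U i t j) W \<and> real_analytic_on (\<lambda>t. V i t j) W)" if "i < r" for i
    using piece[OF that] unfolding analytic_eigenbasis_on_def by blast
  have "piecewise_real_analytic (\<lambda>t. symplectic_eigenvalues (A t) j) a b" for j
  proof (rule piecewise_real_analyticI[OF s])
    show "symplectic_eigenvalues (A t) j = D i t j" if "i < r" "t \<in> {s i<..<s (Suc i)}" for i t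
      using on_piece[OF that] by simp
    show "\<exists>W. open W \<and> {s i..s (Suc i)} \<subseteq> W \<and> real_analytic_on (\<lambda>t. D i t j) W" if "i < r" for i
      using an[OF that] by blast
  qed
  moreover have "piecewise_real_analytic (\<lambda>t. u t j) a b" for j
  proof (rule piecewise_real_analyticI[OF s])
    show "u t j = U i t j" if "i < r" "t \<in> {s i<..<s (Suc i)}" for i t
      using on_piece[OF that] by simp
    show "\<exists>W. open W \<and> {s i..s (Suc i)} \<subseteq> W \<and> real_analytic_on (\<lambda>t. U i t j) W" if "i < r" for i
      using an[OF that] by blast
  qed
  moreover have "piecewise_real_analytic (\<lambda>t. v t j) a b" for j
  proof (rule piecewise_real_analyticI[OF s])
    show "v t j = V i t j" if "i < r" "t \<in> {s i<..<s (Suc i)}" for i t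
      using on_piece[OF that] by simp
    show "\<exists>W. open W \<and> {s i..s (Suc i)} \<subseteq> W \<and> real_analytic_on (\<lambda>t. V i t j) W" if "i < r" for i
      using an[OF that] by blast
  qed
  ultimately show ?thesis using basis by blast
qed

end
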